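(* (1) If $\alpha\in\big(\tfrac13,\tfrac{3-\sqrt5}{2}\big]$, then $\{\dim_H(\Gamma_\alpha\cap(\Gamma_\alpha+t)):t\in S_\alpha\}$ is dense in $\big[0,\tfrac{\log 2}{-\log\alpha}\big]$. (2) If $\alpha\in\big(\tfrac{3-\sqrt5}{2},\tfrac12\big)$, then $\{\dim_H(\Gamma_\alpha\cap(\Gamma_\alpha+t)):t\in S_\alpha\}$ is not dense in $\big[0,\tfrac{\log 2}{-\log\alpha}\big]$.
   Context: For $\alpha\in(0,1/2)$ let $\Gamma_{\alpha}:=\{\sum_{i=1}^{\infty}\epsilon_i\alpha^i:\epsilon_i\in\{0,1\},\ i\geq 1\}$, and for $t\in\mathbb{R}$ let $\Gamma_\alpha+t:=\{x+t:x\in\Gamma_\alpha\}$. Let $\Gamma_\alpha-\Gamma_\alpha=\{\sum_{i=1}^{\infty}\epsilon_i\alpha^i:\epsilon_i\in\{-1,0,1\},\ i\ge 1\}$ be the difference set. An $\alpha$-expansion of $t$ with alphabet $\{-1,0,1\}$ is a sequence $(t_i)_{i\ge1}\in\{-1,0,1\}^{\mathbb{N}}$ with $t=\sum_{i=1}^\infty t_i\alpha^i$. Let $\mathcal{U}_\alpha$ be the set of $t\in\Gamma_\alpha-\Gamma_\alpha$ having exactly one $\alpha$-expansion with alphabet $\{-1,0,1\}$, and let $$S_\alpha:=\{t\in\mathcal{U}_\alpha:\Gamma_\alpha\cap(\Gamma_\alpha+t)\text{ is a self-similar set}\}.$$ A self-similar set is a nonempty compact set $K\subset\mathbb{R}$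 with $K=\bigcup_{j=1}^m g_j(K)$ for some finite collection of contracting similarities $g_1,\dots,g_m$ of $\mathbb{R}$. $\dim_H$ denotes Hausdorff dimension. *)

theory Defs
  imports "HOL-Analysis.Analysis"
begin

(* Contribution diam(U)^s of a covering set.  The case s = 0 is separated because
   0 powr 0 = 0 in the library, whereas a nonempty set must have weight 1 there. *)
definition hausdorff_weight :: "real \<Rightarrow> 'a::metric_space set \<Rightarrow> ennreal" where
  "hausdorff_weight s U =
     (if U = {} then 0 else if s = 0 then 1 else ennreal (diameter U powr s))"

(* Boundedness is required because diameter is 0 on unbounded sets. *)
definition hausdorff_premeasure :: "real \<Rightarrow> real \<Rightarrow> 'a::metric_space set \<Rightarrow> ennreal" where
  "hausdorff_premeasure s \<delta> A =
     (INF U \<in> {U :: nat \<Rightarrow> 'a set.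
                 A \<subseteq> (\<Union>n. U n) \<and> (\<forall>n. bounded (U n) \<and> diameter (U n) \<le> \<delta>)}.
        \<Sum>n. hausdorff_weight s (U n))"

definition hausdorff_measure :: "real \<Rightarrow> 'a::metric_space set \<Rightarrow> ennreal" where
  "hausdorff_measure s A = (SUP \<delta> \<in> {0<..}. hausdorff_premeasure s \<delta> A)"

definition hausdorff_dim :: "'a::metric_space set \<Rightarrow> ereal" where
  "hausdorff_dim A = (INF s \<in> {s :: real. 0 \<le> s \<and> hausdorff_measure s A = 0}. ereal s)"

definition contracting_similarity :: "('a::metric_space \<Rightarrow> 'a) \<Rightarrow> bool" where
  "contracting_similarity g \<longleftrightarrow>
     (\<exists>r. 0 < r \<and> r < 1 \<and> (\<forall>x y. dist (g x) (g y) = r * dist x y))"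

definition self_similar :: "'a::metric_space set \<Rightarrow> bool" where
  "self_similar K \<longleftrightarrow> K \<noteq> {} \<and> compact K \<and>
     (\<exists>G. finite G \<and> (\<forall>g\<in>G. contracting_similarity g) \<and> K = (\<Union>g\<in>G. g ` K))"

(* Digits are indexed from 0: the digit e i belongs to the power Suc i of alpha. *)
definition is_expansion :: "int set \<Rightarrow> real \<Rightarrow> (nat \<Rightarrow> int) \<Rightarrow> real \<Rightarrow> bool" where
  "is_expansion D \<alpha> e t \<longleftrightarrow>
     (\<forall>i. e i \<in> D) \<and> (\<lambda>i. of_int (e i) * \<alpha> ^ Suc i) sums t"

definition Cantor_set :: "real \<Rightarrow> real set" where
  "Cantor_set \<alpha> = {x. \<exists>e. is_expansion {0, 1} \<alpha> e x}"

definition Cantor_diff :: "real \<Rightarrow> real set" where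
  "Cantor_diff \<alpha> = {x - y |x y. x \<in> Cantor_set \<alpha> \<and> y \<in> Cantor_set \<alpha>}"

definition Cantor_inter :: "real \<Rightarrow> real \<Rightarrow> real set" where
  "Cantor_inter \<alpha> t = Cantor_set \<alpha> \<inter> (\<lambda>x. x + t) ` Cantor_set \<alpha>"

definition unique_expansion_set :: "real \<Rightarrow> real set" where
  "unique_expansion_set \<alpha> = {t \<in> Cantor_diff \<alpha>. \<exists>!e. is_expansion {-1, 0, 1} \<alpha> e t}"

definition self_similar_translations :: "real \<Rightarrow> real set" where
  "self_similar_translations \<alpha> =
     {t \<in> unique_expansion_set \<alpha>. self_similar (Cantor_inter \<alpha> t)}"

definition intersection_dims :: "real \<Rightarrow> ereal set" where
  "intersection_dims \<alpha> =
     (\<lambda>t. hausdorff_dim (Cantor_inter \<alpha> t)) ` self_similar_translations \<alpha>"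

end

theory Submission
  imports Defs
begin

text \<open>
If \<open>t\<close> has only one expansion \<open>\<tau>\<close> with digits in \<open>{-1, 0, 1}\<close>, then every way of writing \<open>t\<close> as a
difference of two points of the Cantor set must produce \<open>\<tau>\<close> digit by digit. The intersection of
the Cantor set with its translate by \<open>t\<close> is therefore the set of all digit sums in which the digit
is free wherever \<open>\<tau>\<close> vanishes and forced everywhere else (\<open>Cantor_inter_eq_digits\<close>). Its dimension
is governed by the frequency of zeros in \<open>\<tau>\<close>: frequency \<open>r\<close> gives dimension \<open>r * s\<close>, where
\<open>s = ln 2 / (- ln \<alpha>)\<close> is the dimension of the Cantor set itself. The upper bound counts prefixes, the
lower bound maps the set onto the unit interval by a Hoelder map that reads the free digits as a
binary expansion (\<open>dim_le_of_zero_count\<close>, \<open>dim_ge_of_zero_count\<close>).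

Which sequences \<open>\<tau>\<close> occur is decided by their tails. As \<open>1 / 3 \<le> \<alpha>\<close>, signed digit sequences fill
the interval between \<open>- (\<alpha> / (1 - \<alpha>))\<close> and \<open>\<alpha> / (1 - \<alpha>)\<close>, so raising or lowering a digit by one
can be compensated by the later digits exactly when the tail is at distance at most
\<open>\<alpha> / (1 - \<alpha>)\<close> from \<open>1\<close> or \<open>-1\<close> respectively. With \<open>c = (1 - 2 * \<alpha>) / (1 - \<alpha>)\<close>, uniqueness thus
means that the tail after a digit different from \<open>1\<close> stays below \<open>c\<close>, and the tail after a digit
different from \<open>-1\<close> stays above \<open>-c\<close> (\<open>small_tails\<close>). The bound \<open>(3 - sqrt 5) / 2\<close> is the solution of \<open>c = \<alpha>\<close> below \<open>1 / 2\<close>.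

If \<open>\<alpha> \<le> c\<close>, every sequence in which the nonzero digits recur and alternate in sign has small tails,
because such tails lie strictly between \<open>-\<alpha>\<close> and \<open>\<alpha>\<close>. The positions of the nonzero digits are
arbitrary, so periodic sequences, whose intersections are self-similar, realise every rational
frequency (\<open>rational_density_dimension\<close>).

If \<open>c < \<alpha>\<close>, a digit \<open>1\<close> preceded by a smaller digit forces its tail to be negative and bounded away
from \<open>0\<close>, so a digit \<open>-1\<close> must follow within a bounded number \<open>M\<close> of steps; the first such digit is
again preceded by a larger one, and the argument repeats with the signs exchanged. Hence either
zeros are eventually the only digits and the dimension is \<open>s\<close>, or eventually every block of \<open>M\<close>
digits contains a nonzero one and the dimension is at most \<open>(1 - 1 / M) * s\<close>. (A sequence in which
no nonzero digit is preceded by a different digit is constant up to trailing zeros.) The open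
interval between these two values contains no dimension (\<open>unique_expansion_dimension_gap\<close>).
\<close>

section \<open>Two bounds for the Hausdorff dimension\<close>

text \<open>
A cover of \<open>A\<close> is carried by \<open>\<Phi>\<close> to a cover of the unit interval by intervals whose lengths are
comparable to \<open>diameter powr s\<close>; so the Lebesgue measure of the unit interval bounds the weight of
the cover from below. Here \<open>\<Phi>\<close> depends on the code of a point, since digit
sequences and not points are the natural argument of maps of this kind.
\<close>

lemma hausdorff_dim_ge_of_Hoelder:
  fixes A :: "'a::metric_space set" and code :: "'b \<Rightarrow> 'a" and \<Phi> :: "'b \<Rightarrow> real"
  assumes onto: "{0..1} \<subseteq> \<Phi> ` I" and into: "code ` I \<subseteq> A" and "0 < C"
    and hoelder: "\<And>x y. x \<in> I \<Longrightarrow> y \<in> I \<Longrightarrow> \<bar>\<Phi> x - \<Phi> y\<bar> \<le> C * dist (code x) (code y) powr s"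
  shows "ereal s \<le> hausdorff_dim A"
  unfolding hausdorff_dim_def
proof (rule INF_greatest)
  fix s' assume "s' \<in> {s. 0 \<le> s \<and> hausdorff_measure s A = 0}"
  then have s': "0 \<le> s'" "hausdorff_measure s' A = 0" by auto
  show "ereal s \<le> ereal s'"
  proof (rule ccontr)
    assume "\<not> ereal s \<le> ereal s'"
    then have less: "s' < s" by simp
    have "hausdorff_premeasure s' 1 A \<le> hausdorff_measure s' A"
      unfolding hausdorff_measure_def by (rule SUP_upper) simp
    then have "hausdorff_premeasure s' 1 A < ennreal (1 / (2 * C))"
      using s'(2) \<open>0 < C\<close> by simp
    then obtain U where U: "A \<subseteq> (\<Union>n. U n)" "\<And>n. bounded (U n)" "\<And>n. diameter (U n) \<le> 1"
      and small: "(\<Sum>n. hausdorff_weight s' (U n)) < ennreal (1 / (2 * C))"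
      unfolding hausdorff_premeasure_def INF_less_iff by auto
    \<comment> \<open>the image of \<open>U n\<close> lies within distance \<open>C * diameter (U n) powr s\<close> of any one of its points\<close>
    define J where "J n = (if \<exists>x\<in>I. code x \<in> U n
        then let v = \<Phi> (SOME x. x \<in> I \<and> code x \<in> U n); l = C * diameter (U n) powr s in {v - l .. v + l}
        else {})" for n
    have J: "\<Phi> x \<in> J n" if "x \<in> I" "code x \<in> U n" for x n
    proof -
      define y where "y = (SOME x. x \<in> I \<and> code x \<in> U n)"
      have y: "y \<in> I \<and> code y \<in> U n" unfolding y_def by (rule someI[of _ x]) (use that in auto)
      have "dist (code x) (code y) powr s \<le> diameter (U n) powr s"
        using less s'(1) that y by (intro powr_mono2 diameter_bounded_bound U(2)) auto
      then have "\<bar>\<Phi> x - \<Phi> y\<bar> \<le> C * diameter (U n) powr s"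
        using hoelder[OF that(1) y[THEN conjunct1]] \<open>0 < C\<close>
        by (smt (verit) mult_left_mono)
      then show ?thesis using that unfolding J_def y_def[symmetric] by (auto simp: Let_def)
    qed
    have meas: "J n \<in> sets lborel" for n unfolding J_def Let_def by simp
    have bound: "emeasure lborel (J n) \<le> ennreal (2 * C) * hausdorff_weight s' (U n)" for n
    proof (cases "\<exists>x\<in>I. code x \<in> U n")
      case True
      then have ne: "U n \<noteq> {}" by auto
      have d: "0 \<le> diameter (U n)" by (rule diameter_ge_0[OF U(2)])
      \<comment> \<open>this is where the diameters have to be at most \<open>1\<close>; the case distinction mirrors the weight at exponent \<open>0\<close>\<close>
      have le: "diameter (U n) powr s \<le> (if s' = 0 then 1 else diameter (U n) powr s')"
      proof (cases "diameter (U n) = 0")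
        case False
        then show ?thesis using d U(3)[of n] less s'(1) powr_mono'[of s' s "diameter (U n)"]
          by (auto simp: powr_le1)
      qed auto
      have "emeasure lborel (J n) = ennreal (2 * C * diameter (U n) powr s)"
        using True \<open>0 < C\<close> unfolding J_def Let_def by (simp add: algebra_simps)
      also have "\<dots> \<le> ennreal (2 * C * (if s' = 0 then 1 else diameter (U n) powr s'))"
        using le \<open>0 < C\<close> by (intro ennreal_leI mult_left_mono) auto
      also have "\<dots> = ennreal (2 * C) * hausdorff_weight s' (U n)"
        using ne \<open>0 < C\<close> unfolding hausdorff_weight_def by (auto simp: ennreal_mult)
      finally show ?thesis .
    qed (simp add: J_def)
    have cover: "{0..1} \<subseteq> (\<Union>n. J n)"
    proof
      fix y :: real assume "y \<in> {0..1}"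
      then obtain x where x: "x \<in> I" "y = \<Phi> x" using onto by blast
      then obtain n where "code x \<in> U n" using into U(1) by blast
      then show "y \<in> (\<Union>n. J n)" using J x by blast
    qed
    have "1 = emeasure lborel {0..1::real}" by simp
    also have "\<dots> \<le> emeasure lborel (\<Union>n. J n)" using cover meas by (intro emeasure_mono) auto
    also have "\<dots> \<le> (\<Sum>n. emeasure lborel (J n))"
      using meas by (intro emeasure_subadditive_countably) auto
    also have "\<dots> \<le> (\<Sum>n. ennreal (2 * C) * hausdorff_weight s' (U n))"
      by (intro suminf_le bound) auto
    also have "\<dots> = ennreal (2 * C) * (\<Sum>n. hausdorff_weight s' (U n))" by simp
    also have "\<dots> < ennreal (2 * C) * ennreal (1 / (2 * C))"
      using small \<open>0 < C\<close> by (intro ennreal_mult_strict_left_mono) auto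
    also have "\<dots> = 1" using \<open>0 < C\<close> by (simp flip: ennreal_mult)
    finally show False by simp
  qed
qed

lemma hausdorff_premeasure_le_of_finite_cover:
  fixes A :: "'a::metric_space set"
  assumes "finite P" "A \<subseteq> (\<Union>x\<in>P. V x)" "0 < s"
    and V: "\<And>x. x \<in> P \<Longrightarrow> bounded (V x) \<and> diameter (V x) \<le> \<rho>" and "0 \<le> \<rho>" "\<rho> \<le> \<delta>"
  shows "hausdorff_premeasure s \<delta> A \<le> ennreal (card P * \<rho> powr s)"
proof -
  obtain h where h: "bij_betw h {0..<card P} P"
    using ex_bij_betw_nat_finite[OF \<open>finite P\<close>] by blast
  define U where "U n = (if n < card P then V (h n) else {})" for n
  have hP: "h n \<in> P" if "n < card P" for n using h that by (auto simp: bij_betw_def)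
  have "A \<subseteq> (\<Union>n. U n)"
  proof
    fix a assume "a \<in> A"
    then obtain x where x: "x \<in> P" "a \<in> V x" using assms(2) by blast
    then have "x \<in> h ` {0..<card P}" using h by (simp add: bij_betw_def)
    then obtain n where "n < card P" "h n = x" by auto
    then show "a \<in> (\<Union>n. U n)" using x by (auto simp: U_def)
  qed
  moreover have "bounded (U n) \<and> diameter (U n) \<le> \<delta>" for n
    using V[OF hP, of n] assms(5,6) by (auto simp: U_def)
  ultimately have "hausdorff_premeasure s \<delta> A \<le> (\<Sum>n. hausdorff_weight s (U n))"
    unfolding hausdorff_premeasure_def by (intro INF_lower) auto
  also have "\<dots> = (\<Sum>n<card P. hausdorff_weight s (U n))"
    by (rule suminf_finite) (auto simp: U_def hausdorff_weight_def)
  also have "\<dots> \<le> (\<Sum>n<card P. ennreal (\<rho> powr s))"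
  proof (rule sum_mono)
    fix n assume "n \<in> {..<card P}"
    then have "bounded (U n)" "diameter (U n) \<le> \<rho>" using V[OF hP, of n] by (auto simp: U_def)
    then show "hausdorff_weight s (U n) \<le> ennreal (\<rho> powr s)"
      using \<open>0 < s\<close> diameter_ge_0[of "U n"]
      by (auto simp: hausdorff_weight_def intro!: ennreal_leI powr_mono2)
  qed
  also have "\<dots> = ennreal (card P * \<rho> powr s)"
    by (simp add: ennreal_of_nat_eq_real_of_nat flip: ennreal_mult)
  finally show ?thesis .
qed

lemma hausdorff_dim_le_of_finite_covers:
  fixes A :: "'a::metric_space set"
  assumes "0 < s" and fin: "\<And>n. finite (P n)" and cov: "\<And>n. A \<subseteq> (\<Union>x\<in>P n. V n x)"
    and V: "\<And>n x. x \<in> P n \<Longrightarrow> bounded (V n x) \<and> diameter (V n x) \<le> \<rho> n"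
    and \<rho>: "\<And>n. 0 \<le> \<rho> n" "\<rho> \<longlonglongrightarrow> 0" and lim: "(\<lambda>n. card (P n) * \<rho> n powr s) \<longlonglongrightarrow> 0"
  shows "hausdorff_dim A \<le> ereal s"
proof -
  have "hausdorff_premeasure s \<delta> A = 0" if "0 < \<delta>" for \<delta>
  proof -
    have ev: "\<forall>\<^sub>F n in sequentially. \<rho> n \<le> \<delta>"
      using order_tendstoD(2)[OF \<rho>(2) that] by eventually_elim simp
    have "(\<lambda>n. ennreal (card (P n) * \<rho> n powr s)) \<longlonglongrightarrow> ennreal 0"
      by (rule tendsto_ennrealI[OF lim])
    moreover have "\<forall>\<^sub>F n in sequentially. hausdorff_premeasure s \<delta> A \<le> ennreal (card (P n) * \<rho> n powr s)"
      using ev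
    proof eventually_elim
      case (elim n)
      then show ?case
        using hausdorff_premeasure_le_of_finite_cover[OF fin cov \<open>0 < s\<close> V \<rho>(1), of n \<delta>] by simp
    qed
    ultimately have "hausdorff_premeasure s \<delta> A \<le> ennreal 0"
      by (rule tendsto_lowerbound) simp
    then show ?thesis by simp
  qed
  then have "hausdorff_measure s A = 0" unfolding hausdorff_measure_def by simp
  then show ?thesis using \<open>0 < s\<close> unfolding hausdorff_dim_def by (intro INF_lower) auto
qed

section \<open>Expansions in powers of a small base\<close>

definition digit_value :: "real \<Rightarrow> (nat \<Rightarrow> int) \<Rightarrow> real" where
  "digit_value \<alpha> d = (\<Sum>i. of_int (d i) * \<alpha> ^ Suc i)"

definition signed_digits :: "(nat \<Rightarrow> int) \<Rightarrow> bool" where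
  "signed_digits d \<longleftrightarrow> (\<forall>i. d i \<in> {-1, 0, 1})"

lemma signed_digitsD: "signed_digits d \<Longrightarrow> d i \<in> {-1, 0, 1}"
  by (simp add: signed_digits_def)

lemma signed_digits_abs_le: "signed_digits d \<Longrightarrow> \<bar>d i\<bar> \<le> 1"
  using signed_digitsD[of d i] by auto

lemma signed_digits_shift [simp]: "signed_digits d \<Longrightarrow> signed_digits (\<lambda>i. d (i + n))"
  by (simp add: signed_digits_def)

lemma signed_digits_shift_Suc [simp]: "signed_digits d \<Longrightarrow> signed_digits (\<lambda>i. d (Suc (i + n)))"
  by (simp add: signed_digits_def)

lemma signed_digits_minus [simp]: "signed_digits (\<lambda>i. - d i) \<longleftrightarrow> signed_digits d"
proof -
  have "- d i \<in> {-1, 0, 1} \<longleftrightarrow> d i \<in> {-1, 0, 1}" for i by auto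
  then show ?thesis unfolding signed_digits_def by blast
qed

lemma signed_digits_binary: "\<forall>i. d i \<in> {0, 1} \<Longrightarrow> signed_digits d"
  unfolding signed_digits_def by auto

context
  fixes \<alpha> :: real
  assumes \<alpha>: "0 < \<alpha>" "\<alpha> < 1 / 2"
begin

lemma summable_digits:
  assumes "signed_digits d"
  shows "summable (\<lambda>i. of_int (d i) * \<alpha> ^ Suc i)"
proof (rule summable_comparison_test')
  show "summable (\<lambda>i. \<alpha> ^ Suc i)" using \<alpha> by (simp add: summable_geometric summable_mult)
  have "\<bar>real_of_int (d i)\<bar> \<le> 1" for i using signed_digits_abs_le[OF assms, of i] by linarith
  then show "norm (of_int (d i) * \<alpha> ^ Suc i) \<le> \<alpha> ^ Suc i" for i
    using \<alpha> by (auto simp: abs_mult power_abs intro!: mult_left_le_one_le)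
qed

lemma digit_value_sums:
  assumes "signed_digits d"
  shows "(\<lambda>i. of_int (d i) * \<alpha> ^ Suc i) sums digit_value \<alpha> d"
  using summable_sums[OF summable_digits[OF assms]] unfolding digit_value_def .

lemma is_expansion_iff:
  assumes "D \<subseteq> {-1, 0, 1}"
  shows "is_expansion D \<alpha> d t \<longleftrightarrow> (\<forall>i. d i \<in> D) \<and> digit_value \<alpha> d = t"
proof -
  have "signed_digits d" if "\<forall>i. d i \<in> D" using assms that unfolding signed_digits_def by auto
  then show ?thesis unfolding is_expansion_def using digit_value_sums[of d] sums_unique2 by blast
qed

lemma geometric_sums_Suc: "(\<lambda>i. \<alpha> ^ Suc i) sums (\<alpha> / (1 - \<alpha>))"
  using sums_mult[OF geometric_sums[of \<alpha>], of \<alpha>] \<alpha> by simp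

lemma digit_value_le:
  assumes "signed_digits d"
  shows "digit_value \<alpha> d \<le> \<alpha> / (1 - \<alpha>)"
proof -
  have "of_int (d i) * \<alpha> ^ Suc i \<le> \<alpha> ^ Suc i" for i
    using \<alpha> signed_digits_abs_le[OF assms, of i] mult_right_mono[of "of_int (d i)" 1 "\<alpha> ^ Suc i"] by simp
  then show ?thesis
    using digit_value_sums[OF assms] geometric_sums_Suc by (rule sums_le)
qed

lemma digit_value_diff:
  assumes "signed_digits d" "signed_digits e"
  shows "digit_value \<alpha> (\<lambda>i. d i - e i) = digit_value \<alpha> d - digit_value \<alpha> e"
  using sums_unique[OF sums_diff[OF digit_value_sums[OF assms(1)] digit_value_sums[OF assms(2)]]]
  unfolding digit_value_def by (simp add: algebra_simps)

lemma digit_value_minus: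
  assumes "signed_digits d"
  shows "digit_value \<alpha> (\<lambda>i. - d i) = - digit_value \<alpha> d"
  using digit_value_diff[of "\<lambda>_. 0" d] assms by (simp add: digit_value_def signed_digits_def)

lemma digit_value_ge:
  assumes "signed_digits d"
  shows "- (\<alpha> / (1 - \<alpha>)) \<le> digit_value \<alpha> d"
  using digit_value_le[of "\<lambda>i. - d i"] digit_value_minus[of d] assms by simp

lemma digit_value_nonneg:
  assumes "signed_digits d" "\<And>i. 0 \<le> d i"
  shows "0 \<le> digit_value \<alpha> d"
  unfolding digit_value_def using \<alpha> assms by (intro suminf_nonneg summable_digits) auto

lemma digit_value_split:
  assumes "signed_digits d"
  shows "digit_value \<alpha> d = (\<Sum>i<n. of_int (d i) * \<alpha> ^ Suc i) + \<alpha> ^ n * digit_value \<alpha> (\<lambda>i. d (i + n))"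
proof -
  have "digit_value \<alpha> d = (\<Sum>i. of_int (d (i + n)) * \<alpha> ^ Suc (i + n)) + (\<Sum>i<n. of_int (d i) * \<alpha> ^ Suc i)"
    unfolding digit_value_def by (rule suminf_split_initial_segment[OF summable_digits[OF assms]])
  also have "(\<Sum>i. of_int (d (i + n)) * \<alpha> ^ Suc (i + n)) = \<alpha> ^ n * digit_value \<alpha> (\<lambda>i. d (i + n))"
    unfolding digit_value_def
    by (subst suminf_mult[OF summable_digits[of "\<lambda>i. d (i + n)"], symmetric])
      (simp_all add: assms digit_value_def[symmetric] power_add algebra_simps)
  finally show ?thesis by simp
qed

lemma digit_value_step:
  assumes "signed_digits d"
  shows "digit_value \<alpha> (\<lambda>i. d (i + n)) = \<alpha> * (of_int (d n) + digit_value \<alpha> (\<lambda>i. d (i + Suc n)))"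
  using digit_value_split[of "\<lambda>i. d (i + n)" 1] assms by (simp add: algebra_simps)

lemma digit_value_diff_of_equal_prefix:
  assumes "signed_digits d" "signed_digits e" "\<And>i. i < n \<Longrightarrow> d i = e i"
  shows "digit_value \<alpha> d - digit_value \<alpha> e =
    \<alpha> ^ Suc n * (of_int (d n - e n) + digit_value \<alpha> (\<lambda>i. d (i + Suc n)) - digit_value \<alpha> (\<lambda>i. e (i + Suc n)))"
proof -
  have "(\<Sum>i<n. real_of_int (d i) * \<alpha> ^ Suc i) = (\<Sum>i<n. of_int (e i) * \<alpha> ^ Suc i)"
    using assms(3) by simp
  then show ?thesis
    using digit_value_split[of d n] digit_value_split[of e n] digit_value_step[of d n] digit_value_step[of e n] assms
    by (simp add: algebra_simps)
qed

text \<open>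
Reading off one digit after the other leaves a remainder \<open>\<alpha> ^ n * y\<close> with \<open>y \<in> A\<close>, which tends to
\<open>0\<close> because \<open>A\<close> is bounded. The lemma serves twice: it shows that the Cantor set is closed, and that
an interval consists of numbers with signed expansions.
\<close>

lemma expansions_of_invariant_set:
  assumes "bounded A" and D: "D \<subseteq> {-1, 0, 1}" and "x \<in> A"
    and step: "\<And>x. x \<in> A \<Longrightarrow> \<exists>d\<in>D. \<exists>y\<in>A. x = \<alpha> * (of_int d + y)"
  shows "\<exists>e. is_expansion D \<alpha> e x"
proof -
  obtain dig nxt where dn: "\<And>x. x \<in> A \<Longrightarrow> dig x \<in> D" "\<And>x. x \<in> A \<Longrightarrow> nxt x \<in> A"
    "\<And>x. x \<in> A \<Longrightarrow> x = \<alpha> * (of_int (dig x) + nxt x)"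
    using step by metis
  define r where "r n = (nxt ^^ n) x" for n
  define e where "e n = dig (r n)" for n
  have r: "r n \<in> A" for n by (induction n) (auto simp: r_def \<open>x \<in> A\<close> dn)
  have part: "(\<Sum>i<n. of_int (e i) * \<alpha> ^ Suc i) = x - \<alpha> ^ n * r n" for n
  proof (induction n)
    case (Suc n)
    have "r n = \<alpha> * (of_int (e n) + r (Suc n))" using dn(3)[OF r[of n]] by (simp add: e_def r_def)
    then show ?case using Suc by (simp add: algebra_simps)
  qed (simp add: r_def)
  obtain B where B: "\<And>y. y \<in> A \<Longrightarrow> \<bar>y\<bar> \<le> B" using \<open>bounded A\<close> by (auto simp: bounded_iff)
  have "(\<lambda>n. \<alpha> ^ n * r n) \<longlonglongrightarrow> 0"
  proof (rule Lim_null_comparison)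
    show "\<forall>\<^sub>F n in sequentially. norm (\<alpha> ^ n * r n) \<le> \<alpha> ^ n * B"
      using \<alpha> B[OF r] by (auto simp: abs_mult power_abs intro!: always_eventually mult_left_mono)
    show "(\<lambda>n. \<alpha> ^ n * B) \<longlonglongrightarrow> 0"
      using \<alpha> by (intro tendsto_mult_left_zero LIMSEQ_realpow_zero) auto
  qed
  then have "(\<lambda>n. x - \<alpha> ^ n * r n) \<longlonglongrightarrow> x - 0" by (intro tendsto_intros)
  then have "(\<lambda>i. of_int (e i) * \<alpha> ^ Suc i) sums x" unfolding sums_def part by simp
  then show ?thesis using dn(1)[OF r] unfolding is_expansion_def by (intro exI[of _ e]) (simp add: e_def)
qed

end

section \<open>Unique expansions and their tails\<close>

text \<open>
The value of the digits after position \<open>n\<close>, rescaled so that digit \<open>n\<close> itself has weight \<open>1\<close>.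
\<close>

definition tail_value :: "real \<Rightarrow> (nat \<Rightarrow> int) \<Rightarrow> nat \<Rightarrow> real" where
  "tail_value \<alpha> \<tau> n = digit_value \<alpha> (\<lambda>i. \<tau> (i + Suc n))"

text \<open>
The bound is \<open>1 - \<alpha> / (1 - \<alpha>)\<close>, the least number \<open>x\<close> for which \<open>x - 1\<close> is the value of a signed digit
sequence.
\<close>

definition small_tails :: "real \<Rightarrow> (nat \<Rightarrow> int) \<Rightarrow> bool" where
  "small_tails \<alpha> \<tau> \<longleftrightarrow>
    (\<forall>n. (\<tau> n < 1 \<longrightarrow> tail_value \<alpha> \<tau> n < (1 - 2 * \<alpha>) / (1 - \<alpha>)) \<and>
         (-1 < \<tau> n \<longrightarrow> - ((1 - 2 * \<alpha>) / (1 - \<alpha>)) < tail_value \<alpha> \<tau> n))"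

context
  fixes \<alpha> :: real
  assumes \<alpha>: "0 < \<alpha>" "\<alpha> < 1 / 2"
begin

private lemma gap_eq: "1 - \<alpha> / (1 - \<alpha>) = (1 - 2 * \<alpha>) / (1 - \<alpha>)" and gap_pos: "0 < (1 - 2 * \<alpha>) / (1 - \<alpha>)"
  using \<alpha> by (auto simp: field_simps)

lemma is_signed_expansion_iff:
  "is_expansion {-1, 0, 1} \<alpha> e t \<longleftrightarrow> signed_digits e \<and> digit_value \<alpha> e = t"
  unfolding signed_digits_def by (rule is_expansion_iff[OF \<alpha> order_refl])

lemma Cantor_set_eq: "Cantor_set \<alpha> = digit_value \<alpha> ` {e. \<forall>i. e i \<in> {0, 1}}"
proof -
  have "is_expansion {0, 1} \<alpha> e x \<longleftrightarrow> (\<forall>i. e i \<in> {0, 1}) \<and> digit_value \<alpha> e = x" for e x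
    by (rule is_expansion_iff[OF \<alpha>]) auto
  then show ?thesis unfolding Cantor_set_def by (simp only:) blast
qed

text \<open>
At the first position where two expansions of the same number differ, the larger digit of one must
be compensated by the tail of the other, which small tails do not allow.
\<close>

lemma expansion_unique_of_small_tails:
  assumes \<tau>: "signed_digits \<tau>" and small: "small_tails \<alpha> \<tau>"
    and e: "is_expansion {-1, 0, 1} \<alpha> e (digit_value \<alpha> \<tau>)"
  shows "e = \<tau>"
proof (rule ccontr)
  assume "e \<noteq> \<tau>"
  then have ex: "\<exists>i. e i \<noteq> \<tau> i" by auto
  define n where "n = (LEAST i. e i \<noteq> \<tau> i)"
  have n: "e n \<noteq> \<tau> n" unfolding n_def using ex by (rule LeastI_ex)
  have eq: "e i = \<tau> i" if "i < n" for i using that not_less_Least[of i] unfolding n_def by blast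
  have ed: "signed_digits e" "digit_value \<alpha> e = digit_value \<alpha> \<tau>"
    using e is_signed_expansion_iff by auto
  have "of_int (e n - \<tau> n) + tail_value \<alpha> e n - tail_value \<alpha> \<tau> n = 0"
    using digit_value_diff_of_equal_prefix[OF \<alpha> ed(1) \<tau> eq] ed \<alpha>
    unfolding tail_value_def by simp
  moreover have "\<bar>tail_value \<alpha> e n\<bar> \<le> \<alpha> / (1 - \<alpha>)"
    using digit_value_le[OF \<alpha>, of "\<lambda>i. e (i + Suc n)"] digit_value_ge[OF \<alpha>, of "\<lambda>i. e (i + Suc n)"]
      ed(1) unfolding tail_value_def by (auto simp: abs_le_iff)
  moreover have "(\<tau> n < 1 \<and> 1 \<le> e n - \<tau> n) \<or> (-1 < \<tau> n \<and> e n - \<tau> n \<le> -1)"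
    using n signed_digitsD[OF ed(1), of n] signed_digitsD[OF \<tau>, of n] by auto
  then have "(\<tau> n < 1 \<and> (1::real) \<le> of_int (e n - \<tau> n)) \<or> (-1 < \<tau> n \<and> real_of_int (e n - \<tau> n) \<le> -1)"
    by linarith
  ultimately show False using small[unfolded small_tails_def, rule_format, of n] gap_eq by linarith
qed

text \<open>
For \<open>1 / 3 \<le> \<alpha>\<close> the three copies of the interval scaled by \<open>\<alpha>\<close> and shifted by \<open>-\<alpha>, 0, \<alpha>\<close> leave no gap, so
that they cover the interval.
\<close>

lemma expansion_of_interval:
  assumes "1 / 3 \<le> \<alpha>" "\<bar>x\<bar> \<le> \<alpha> / (1 - \<alpha>)"
  shows "\<exists>e. is_expansion {-1, 0, 1} \<alpha> e x"
proof (rule expansions_of_invariant_set[OF \<alpha>, of "{- (\<alpha> / (1 - \<alpha>)) .. \<alpha> / (1 - \<alpha>)}"])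
  let ?b = "\<alpha> / (1 - \<alpha>)"
  fix x assume "x \<in> {- ?b .. ?b}"
  then have x: "- (1 + ?b) \<le> x / \<alpha>" "x / \<alpha> \<le> 1 + ?b" using \<alpha> by (auto simp: field_simps)
  have b: "1 / 2 \<le> ?b" using \<alpha> assms(1) by (auto simp: field_simps)
  define d :: int where "d = (if x / \<alpha> > ?b then 1 else if x / \<alpha> < - ?b then -1 else 0)"
  have "d \<in> {-1, 0, 1}" by (auto simp: d_def)
  moreover have "x / \<alpha> - of_int d \<in> {- ?b .. ?b}" using x b unfolding d_def atLeastAtMost_iff by (simp, linarith)
  moreover have "x = \<alpha> * (of_int d + (x / \<alpha> - of_int d))" using \<alpha> by simp
  ultimately show "\<exists>d\<in>{-1, 0, 1}. \<exists>y\<in>{- ?b .. ?b}. x = \<alpha> * (of_int d + y)" by blast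
qed (use assms in auto)

text \<open>
A larger tail can be lowered by \<open>1\<close> and expanded anew, which pays for raising digit \<open>n\<close> by one and
gives a second expansion.
\<close>

lemma tail_less_of_unique:
  assumes "1 / 3 \<le> \<alpha>" and \<tau>: "signed_digits \<tau>"
    and uniq: "\<And>e. is_expansion {-1, 0, 1} \<alpha> e (digit_value \<alpha> \<tau>) \<Longrightarrow> e = \<tau>" and "\<tau> n < 1"
  shows "tail_value \<alpha> \<tau> n < (1 - 2 * \<alpha>) / (1 - \<alpha>)"
proof (rule ccontr)
  assume "\<not> ?thesis"
  then have "1 - \<alpha> / (1 - \<alpha>) \<le> tail_value \<alpha> \<tau> n" using gap_eq by simp
  moreover have "tail_value \<alpha> \<tau> n \<le> \<alpha> / (1 - \<alpha>)"
    unfolding tail_value_def by (intro digit_value_le[OF \<alpha>] signed_digits_shift \<tau>)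
  moreover have "\<alpha> / (1 - \<alpha>) \<le> 1" using \<alpha> by (auto simp: field_simps)
  ultimately have "\<bar>tail_value \<alpha> \<tau> n - 1\<bar> \<le> \<alpha> / (1 - \<alpha>)" by linarith
  then obtain f where f: "is_expansion {-1, 0, 1} \<alpha> f (tail_value \<alpha> \<tau> n - 1)"
    using expansion_of_interval assms(1) by blast
  then have fd: "signed_digits f" "digit_value \<alpha> f = tail_value \<alpha> \<tau> n - 1"
    using is_signed_expansion_iff by auto
  define e where "e i = (if i < n then \<tau> i else if i = n then \<tau> n + 1 else f (i - Suc n))" for i
  have "e i \<in> {-1, 0, 1}" for i
    using signed_digitsD[OF \<tau>, of i] signed_digitsD[OF \<tau>, of n] \<open>\<tau> n < 1\<close>
      signed_digitsD[OF fd(1), of "i - Suc n"] unfolding e_def by auto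
  then have ed: "signed_digits e" unfolding signed_digits_def by blast
  have eq: "e i = \<tau> i" if "i < n" for i using that by (simp add: e_def)
  have "(\<lambda>i. e (i + Suc n)) = f" by (auto simp: e_def)
  then have "digit_value \<alpha> e - digit_value \<alpha> \<tau> = 0"
    using digit_value_diff_of_equal_prefix[OF \<alpha> ed \<tau> eq] fd(2)
    unfolding tail_value_def by (simp add: e_def[of n])
  then have "is_expansion {-1, 0, 1} \<alpha> e (digit_value \<alpha> \<tau>)"
    using is_signed_expansion_iff ed by auto
  then have "e n = \<tau> n" using uniq by blast
  then show False by (simp add: e_def)
qed

lemma tail_value_minus:
  assumes "signed_digits \<tau>"
  shows "tail_value \<alpha> (\<lambda>i. - \<tau> i) n = - tail_value \<alpha> \<tau> n"
  unfolding tail_value_def by (rule digit_value_minus[OF \<alpha> signed_digits_shift[OF assms]])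

lemma small_tails_minus:
  assumes "signed_digits \<tau>" "small_tails \<alpha> \<tau>"
  shows "small_tails \<alpha> (\<lambda>i. - \<tau> i)"
  unfolding small_tails_def tail_value_minus[OF assms(1)]
proof (intro allI conjI impI)
  fix n
  note * = assms(2)[unfolded small_tails_def, rule_format, of n]
  show "- tail_value \<alpha> \<tau> n < (1 - 2 * \<alpha>) / (1 - \<alpha>)" if "- \<tau> n < 1"
    using that conjunct2[OF *] by linarith
  show "- ((1 - 2 * \<alpha>) / (1 - \<alpha>)) < - tail_value \<alpha> \<tau> n" if "-1 < - \<tau> n"
    using that conjunct1[OF *] by linarith
qed

lemma small_tails_of_unique:
  assumes "1 / 3 \<le> \<alpha>" and \<tau>: "signed_digits \<tau>"
    and uniq: "\<And>e. is_expansion {-1, 0, 1} \<alpha> e (digit_value \<alpha> \<tau>) \<Longrightarrow> e = \<tau>"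
  shows "small_tails \<alpha> \<tau>"
proof -
  have neg: "signed_digits (\<lambda>i. - \<tau> i)" using \<tau> by simp
  have "e = (\<lambda>i. - \<tau> i)" if e: "is_expansion {-1, 0, 1} \<alpha> e (digit_value \<alpha> (\<lambda>i. - \<tau> i))" for e
  proof -
    have "is_expansion {-1, 0, 1} \<alpha> (\<lambda>i. - e i) (digit_value \<alpha> \<tau>)"
      using e \<tau> digit_value_minus[OF \<alpha>] by (simp add: is_signed_expansion_iff)
    then have "(\<lambda>i. - e i) = \<tau>" by (rule uniq)
    then show ?thesis by auto
  qed
  from tail_less_of_unique[OF assms(1) neg this] tail_less_of_unique[OF assms(1) \<tau> uniq]
  have "\<tau> n < 1 \<longrightarrow> tail_value \<alpha> \<tau> n < (1 - 2 * \<alpha>) / (1 - \<alpha>)"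
    and "- \<tau> n < 1 \<longrightarrow> - tail_value \<alpha> \<tau> n < (1 - 2 * \<alpha>) / (1 - \<alpha>)" for n
    unfolding tail_value_minus[OF \<tau>] by blast+
  then show ?thesis unfolding small_tails_def by (smt (verit))
qed

end

section \<open>The intersection as a restricted digit set\<close>

text \<open>
The minuends in representations of \<open>\<tau>\<close> as a difference of two binary sequences: digit \<open>i\<close> is free
if \<open>\<tau> i = 0\<close>, and is forced to be \<open>1\<close> or \<open>0\<close> if \<open>\<tau> i\<close> is \<open>1\<close> or \<open>-1\<close>.
\<close>

definition inter_digits :: "(nat \<Rightarrow> int) \<Rightarrow> (nat \<Rightarrow> int) set" where
  "inter_digits \<tau> = {e. \<forall>i. e i \<in> {0, 1} \<and> e i - \<tau> i \<in> {0, 1}}"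

definition zero_count :: "(nat \<Rightarrow> int) \<Rightarrow> nat \<Rightarrow> nat" where
  "zero_count \<tau> n = (\<Sum>i<n. of_bool (\<tau> i = 0))"

definition prefix_values :: "real \<Rightarrow> (nat \<Rightarrow> int) \<Rightarrow> nat \<Rightarrow> real set" where
  "prefix_values \<alpha> \<tau> n = (\<lambda>e. \<Sum>i<n. of_int (e i) * \<alpha> ^ Suc i) ` inter_digits \<tau>"

lemma inter_digits_signed: "e \<in> inter_digits \<tau> \<Longrightarrow> signed_digits e"
  by (rule signed_digits_binary) (simp add: inter_digits_def)

lemma inter_digits_nonneg: "e \<in> inter_digits \<tau> \<Longrightarrow> 0 \<le> e i"
proof -
  assume "e \<in> inter_digits \<tau>"
  then have "e i \<in> {0, 1}" unfolding inter_digits_def by blast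
  then show ?thesis by auto
qed

lemma inter_digits_nonempty:
  assumes "signed_digits \<tau>"
  shows "(\<lambda>i. max (\<tau> i) 0) \<in> inter_digits \<tau>"
proof -
  have "max (\<tau> i) 0 \<in> {0, 1} \<and> max (\<tau> i) 0 - \<tau> i \<in> {0, 1}" for i
    using signed_digitsD[OF assms, of i] by auto
  then show ?thesis unfolding inter_digits_def by blast
qed

lemma zero_count_0 [simp]: "zero_count \<tau> 0 = 0"
  and zero_count_Suc [simp]: "zero_count \<tau> (Suc n) = zero_count \<tau> n + of_bool (\<tau> n = 0)"
  by (simp_all add: zero_count_def)

context
  fixes \<alpha> :: real
  assumes \<alpha>: "0 < \<alpha>" "\<alpha> < 1 / 2"
begin

lemma digit_value_in_Cantor_diff:
  assumes \<tau>: "signed_digits \<tau>"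
  shows "digit_value \<alpha> \<tau> \<in> Cantor_diff \<alpha>"
proof -
  define e where "e i = max (\<tau> i) 0" for i
  define f where "f i = max (- \<tau> i) 0" for i
  have "e i \<in> {0, 1} \<and> f i \<in> {0, 1}" for i
    using signed_digitsD[OF \<tau>, of i] by (auto simp: e_def f_def)
  then have ef: "\<forall>i. e i \<in> {0, 1}" "\<forall>i. f i \<in> {0, 1}" by blast+
  have "(\<lambda>i. e i - f i) = \<tau>" by (auto simp: e_def f_def)
  then have "digit_value \<alpha> \<tau> = digit_value \<alpha> e - digit_value \<alpha> f"
    using digit_value_diff[OF \<alpha> ef[THEN signed_digits_binary]] by simp
  moreover have "digit_value \<alpha> e \<in> Cantor_set \<alpha>" "digit_value \<alpha> f \<in> Cantor_set \<alpha>"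
    unfolding Cantor_set_eq[OF \<alpha>] using ef by auto
  ultimately show ?thesis unfolding Cantor_diff_def by blast
qed

lemma Cantor_inter_eq_digits:
  assumes \<tau>: "signed_digits \<tau>"
    and uniq: "\<And>e. is_expansion {-1, 0, 1} \<alpha> e (digit_value \<alpha> \<tau>) \<Longrightarrow> e = \<tau>"
  shows "Cantor_inter \<alpha> (digit_value \<alpha> \<tau>) = digit_value \<alpha> ` inter_digits \<tau>"
proof (intro equalityI subsetI)
  fix x assume "x \<in> Cantor_inter \<alpha> (digit_value \<alpha> \<tau>)"
  then obtain e f where e: "\<forall>i. e i \<in> {0, 1}" "digit_value \<alpha> e = x"
    and f: "\<forall>i. f i \<in> {0, 1}" "x = digit_value \<alpha> f + digit_value \<alpha> \<tau>"
    unfolding Cantor_inter_def Cantor_set_eq[OF \<alpha>] by auto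
  have "e i - f i \<in> {-1, 0, 1}" for i using e(1)[rule_format, of i] f(1)[rule_format, of i] by auto
  then have "is_expansion {-1, 0, 1} \<alpha> (\<lambda>i. e i - f i) (digit_value \<alpha> \<tau>)"
    using digit_value_diff[OF \<alpha> e(1)[THEN signed_digits_binary] f(1)[THEN signed_digits_binary]] e(2) f(2)
    unfolding is_signed_expansion_iff[OF \<alpha>] signed_digits_def by simp
  then have "(\<lambda>i. e i - f i) = \<tau>" by (rule uniq)
  then have eq: "e i - \<tau> i = f i" for i by auto
  have "e \<in> inter_digits \<tau>" unfolding inter_digits_def mem_Collect_eq eq using e(1) f(1) by blast
  then show "x \<in> digit_value \<alpha> ` inter_digits \<tau>" using e(2) by blast
next
  fix x assume "x \<in> digit_value \<alpha> ` inter_digits \<tau>"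
  then obtain e where e: "\<forall>i. e i \<in> {0, 1}" "\<forall>i. e i - \<tau> i \<in> {0, 1}" and x: "x = digit_value \<alpha> e"
    unfolding inter_digits_def by auto
  have "digit_value \<alpha> (\<lambda>i. e i - \<tau> i) = x - digit_value \<alpha> \<tau>"
    using digit_value_diff[OF \<alpha> e(1)[THEN signed_digits_binary] \<tau>] x by simp
  then have "x - digit_value \<alpha> \<tau> \<in> Cantor_set \<alpha>"
    unfolding Cantor_set_eq[OF \<alpha>] using e(2) by (intro image_eqI[of _ _ "\<lambda>i. e i - \<tau> i"]) auto
  moreover have "x \<in> Cantor_set \<alpha>" unfolding Cantor_set_eq[OF \<alpha>] using e(1) x by blast
  ultimately show "x \<in> Cantor_inter \<alpha> (digit_value \<alpha> \<tau>)"
    unfolding Cantor_inter_def by (intro IntI image_eqI[of _ _ "x - digit_value \<alpha> \<tau>"]) auto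
qed

text \<open>
The inclusion of the Cantor set in the union of its two scaled copies passes to the closure, and
by \<open>expansions_of_invariant_set\<close> every point of a bounded set with this property has a binary
expansion; so the closure is the Cantor set.
\<close>

lemma compact_Cantor_set: "compact (Cantor_set \<alpha>)"
proof -
  have sub: "Cantor_set \<alpha> \<subseteq> {- (\<alpha> / (1 - \<alpha>)) .. \<alpha> / (1 - \<alpha>)}"
  proof
    fix x assume "x \<in> Cantor_set \<alpha>"
    then obtain e where e: "\<forall>i. e i \<in> {0, 1}" "digit_value \<alpha> e = x" unfolding Cantor_set_eq[OF \<alpha>] by auto
    then show "x \<in> {- (\<alpha> / (1 - \<alpha>)) .. \<alpha> / (1 - \<alpha>)}"
      using digit_value_le[OF \<alpha>, of e] digit_value_ge[OF \<alpha>, of e] e signed_digits_binary by auto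
  qed
  then have bdd: "bounded (Cantor_set \<alpha>)" using bounded_subset bounded_closed_interval by blast
  define A where "A = closure (Cantor_set \<alpha>)"
  have A: "compact A" unfolding A_def using bdd by simp
  let ?h = "\<lambda>(d::int) y. \<alpha> * (of_int d + y)"
  have "Cantor_set \<alpha> \<subseteq> ?h 0 ` A \<union> ?h 1 ` A"
  proof
    fix x assume "x \<in> Cantor_set \<alpha>"
    then obtain e where e: "\<forall>i. e i \<in> {0, 1}" "digit_value \<alpha> e = x" unfolding Cantor_set_eq[OF \<alpha>] by auto
    have "digit_value \<alpha> (\<lambda>i. e (i + 1)) \<in> Cantor_set \<alpha>"
      unfolding Cantor_set_eq[OF \<alpha>] using e(1) by (intro imageI) simp
    then have "digit_value \<alpha> (\<lambda>i. e (i + 1)) \<in> A" unfolding A_def using closure_subset by blast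
    moreover have "x = ?h (e 0) (digit_value \<alpha> (\<lambda>i. e (i + 1)))"
      using digit_value_step[OF \<alpha> signed_digits_binary[OF e(1)], of 0] e(2) by simp
    ultimately show "x \<in> ?h 0 ` A \<union> ?h 1 ` A" using e(1)[rule_format, of 0] by auto
  qed
  moreover have "closed (?h 0 ` A \<union> ?h 1 ` A)"
    by (intro closed_Un compact_imp_closed compact_continuous_image A continuous_intros)
  ultimately have "A \<subseteq> ?h 0 ` A \<union> ?h 1 ` A"
    by (subst A_def) (rule closure_minimal)
  then have "\<exists>d\<in>{0, 1}. \<exists>y\<in>A. x = ?h d y" if "x \<in> A" for x using that by auto
  then have "A \<subseteq> Cantor_set \<alpha>"
    unfolding Cantor_set_def
    using expansions_of_invariant_set[OF \<alpha> compact_imp_bounded[OF A], of "{0, 1}"] by auto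
  then have "A = Cantor_set \<alpha>" unfolding A_def using closure_subset by blast
  then show ?thesis using A by simp
qed

lemma compact_Cantor_inter: "compact (Cantor_inter \<alpha> t)"
  unfolding Cantor_inter_def
  by (intro compact_Int compact_Cantor_set compact_continuous_image continuous_intros)

lemma finite_prefix_values: "finite (prefix_values \<alpha> \<tau> n)"
  and card_prefix_values: "card (prefix_values \<alpha> \<tau> n) \<le> 2 ^ zero_count \<tau> n"
proof -
  have "finite (prefix_values \<alpha> \<tau> n) \<and> card (prefix_values \<alpha> \<tau> n) \<le> 2 ^ zero_count \<tau> n"
  proof (induction n)
    case 0
    have sub: "prefix_values \<alpha> \<tau> 0 \<subseteq> {0}" by (auto simp: prefix_values_def)
    then have "card (prefix_values \<alpha> \<tau> 0) \<le> card {0::real}" by (intro card_mono) auto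
    then show ?case using finite_subset[OF sub] by simp
  next
    case (Suc n)
    define D where "D = {d::int. d \<in> {0, 1} \<and> d - \<tau> n \<in> {0, 1}}"
    have D: "D \<subseteq> (if \<tau> n = 0 then {0, 1} else if \<tau> n = 1 then {1} else {0})" by (auto simp: D_def)
    have finD: "finite D" by (rule finite_subset[OF D]) auto
    have cardD: "card D \<le> 2 ^ of_bool (\<tau> n = 0)"
      using card_mono[OF _ D] by (cases "\<tau> n = 0"; cases "\<tau> n = 1") simp_all
    let ?g = "\<lambda>(x, d). x + of_int d * \<alpha> ^ Suc n"
    have sub: "prefix_values \<alpha> \<tau> (Suc n) \<subseteq> ?g ` (prefix_values \<alpha> \<tau> n \<times> D)"
    proof
      fix x assume "x \<in> prefix_values \<alpha> \<tau> (Suc n)"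
      then obtain e where e: "e \<in> inter_digits \<tau>" "x = (\<Sum>i<Suc n. of_int (e i) * \<alpha> ^ Suc i)"
        by (auto simp: prefix_values_def)
      then have "e n \<in> D" by (auto simp: inter_digits_def D_def)
      moreover have "(\<Sum>i<n. of_int (e i) * \<alpha> ^ Suc i) \<in> prefix_values \<alpha> \<tau> n"
        using e(1) by (auto simp: prefix_values_def)
      ultimately show "x \<in> ?g ` (prefix_values \<alpha> \<tau> n \<times> D)" using e(2) by force
    qed
    have "card (prefix_values \<alpha> \<tau> (Suc n)) \<le> card (?g ` (prefix_values \<alpha> \<tau> n \<times> D))"
      using sub Suc finD by (intro card_mono) auto
    also have "\<dots> \<le> card (prefix_values \<alpha> \<tau> n \<times> D)" using Suc finD by (intro card_image_le) auto
    also have "\<dots> \<le> 2 ^ zero_count \<tau> n * 2 ^ of_bool (\<tau> n = 0)"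
      unfolding card_cartesian_product using Suc cardD by (intro mult_mono) auto
    finally show ?case using finite_subset[OF sub] Suc finD by (simp add: power_add)
  qed
  then show "finite (prefix_values \<alpha> \<tau> n)" "card (prefix_values \<alpha> \<tau> n) \<le> 2 ^ zero_count \<tau> n" by auto
qed

text \<open>
If \<open>\<tau>\<close> has period \<open>p\<close>, dropping \<open>p\<close> digits maps the admissible sequences onto themselves, and
every admissible prefix of length \<open>p\<close> can be combined with every admissible sequence.
\<close>

lemma self_similar_Cantor_inter:
  assumes \<tau>: "signed_digits \<tau>"
    and uniq: "\<And>e. is_expansion {-1, 0, 1} \<alpha> e (digit_value \<alpha> \<tau>) \<Longrightarrow> e = \<tau>"
    and "0 < p" and per: "\<And>i. \<tau> (i + p) = \<tau> i"
  shows "self_similar (Cantor_inter \<alpha> (digit_value \<alpha> \<tau>))"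
proof -
  define K where "K = digit_value \<alpha> ` inter_digits \<tau>"
  have K: "Cantor_inter \<alpha> (digit_value \<alpha> \<tau>) = K"
    unfolding K_def by (rule Cantor_inter_eq_digits[OF \<tau> uniq])
  define G where "G = (\<lambda>x z. x + \<alpha> ^ p * z) ` prefix_values \<alpha> \<tau> p"
  have "contracting_similarity g" if "g \<in> G" for g
  proof -
    obtain x where g: "g = (\<lambda>z. x + \<alpha> ^ p * z)" using \<open>g \<in> G\<close> unfolding G_def by blast
    have "\<alpha> ^ p < 1" using \<alpha> \<open>0 < p\<close> by (simp add: power_less_one_iff)
    moreover have "dist (g u) (g v) = \<alpha> ^ p * dist u v" for u v
      using \<alpha> unfolding g dist_real_def by (simp add: abs_mult flip: right_diff_distrib)
    ultimately show ?thesis unfolding contracting_similarity_def using \<alpha> by (intro exI[of _ "\<alpha> ^ p"]) auto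
  qed
  moreover have "K = (\<Union>g\<in>G. g ` K)"
  proof (intro equalityI subsetI)
    fix x assume "x \<in> K"
    then obtain e where e: "e \<in> inter_digits \<tau>" "x = digit_value \<alpha> e" by (auto simp: K_def)
    have "e (i + p) \<in> {0, 1} \<and> e (i + p) - \<tau> i \<in> {0, 1}" for i
      using e(1) unfolding inter_digits_def per[of i, symmetric] by blast
    then have "(\<lambda>i. e (i + p)) \<in> inter_digits \<tau>" unfolding inter_digits_def by blast
    moreover have "x = (\<Sum>i<p. of_int (e i) * \<alpha> ^ Suc i) + \<alpha> ^ p * digit_value \<alpha> (\<lambda>i. e (i + p))"
      using digit_value_split[OF \<alpha> inter_digits_signed[OF e(1)]] e(2) by simp
    ultimately show "x \<in> (\<Union>g\<in>G. g ` K)" using e(1) unfolding G_def prefix_values_def K_def by auto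
  next
    fix x assume "x \<in> (\<Union>g\<in>G. g ` K)"
    then obtain e f where e: "e \<in> inter_digits \<tau>" and f: "f \<in> inter_digits \<tau>"
      and x: "x = (\<Sum>i<p. of_int (e i) * \<alpha> ^ Suc i) + \<alpha> ^ p * digit_value \<alpha> f"
      unfolding G_def prefix_values_def K_def by auto
    define h where "h i = (if i < p then e i else f (i - p))" for i
    have "h i \<in> {0, 1} \<and> h i - \<tau> i \<in> {0, 1}" for i
    proof (cases "i < p")
      case True
      then show ?thesis using e unfolding inter_digits_def h_def by auto
    next
      case False
      then have "\<tau> i = \<tau> (i - p)" using per[of "i - p"] by simp
      then show ?thesis using f False unfolding inter_digits_def h_def by auto
    qed
    then have h: "h \<in> inter_digits \<tau>" unfolding inter_digits_def by blast
    have "(\<lambda>i. h (i + p)) = f" by (auto simp: h_def)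
    moreover have "(\<Sum>i<p. of_int (h i) * \<alpha> ^ Suc i) = (\<Sum>i<p. of_int (e i) * \<alpha> ^ Suc i)"
      by (simp add: h_def)
    ultimately have "x = digit_value \<alpha> h" using digit_value_split[OF \<alpha> inter_digits_signed[OF h], of p] x by simp
    then show "x \<in> K" using h by (auto simp: K_def)
  qed
  moreover have "finite G" unfolding G_def using finite_prefix_values by blast
  moreover have "K \<noteq> {}" using inter_digits_nonempty[OF \<tau>] unfolding K_def by blast
  ultimately show ?thesis using compact_Cantor_inter unfolding self_similar_def K[symmetric] by blast
qed

end

section \<open>The dimension of the intersection\<close>

context
  fixes \<alpha> :: real
  assumes \<alpha>: "0 < \<alpha>" "\<alpha> < 1 / 2"
begin

text \<open>
The number \<open>ln 2 / (- ln \<alpha>)\<close> is the exponent at which \<open>\<alpha>\<close> becomes \<open>1 / 2\<close>.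
\<close>

lemma base_powr: "\<alpha> powr (r * (ln 2 / (- ln \<alpha>))) = 2 powr (- r)"
proof -
  have "ln \<alpha> < 0" using \<alpha> by simp
  then show ?thesis using \<alpha> by (simp add: powr_def)
qed

text \<open>
At most \<open>2 ^ zero_count \<tau> n\<close> intervals of length \<open>\<alpha> ^ n\<close>, which begin at the prefix values, cover the
set, and for every exponent above the claimed bound their total weight decays geometrically in \<open>n\<close>.
\<close>

lemma dim_le_of_zero_count:
  assumes "0 \<le> r" and count: "\<And>n. real (zero_count \<tau> n) \<le> r * n + C"
  shows "hausdorff_dim (digit_value \<alpha> ` inter_digits \<tau>) \<le> ereal (r * (ln 2 / (- ln \<alpha>)))"
proof (rule dense_ge)
  fix z assume z: "ereal (r * (ln 2 / (- ln \<alpha>))) < z"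
  have neg: "ln \<alpha> < 0" using \<alpha> by simp
  have le: "hausdorff_dim (digit_value \<alpha> ` inter_digits \<tau>) \<le> ereal s"
    if s: "r * (ln 2 / (- ln \<alpha>)) < s" for s
  proof (rule hausdorff_dim_le_of_finite_covers)
    have "0 \<le> r * (ln 2 / (- ln \<alpha>))" using neg \<open>0 \<le> r\<close> by (intro mult_nonneg_nonneg divide_nonneg_pos) auto
    then show "0 < s" using s by linarith
    show "finite (prefix_values \<alpha> \<tau> n)" for n by (rule finite_prefix_values[OF \<alpha>])
    show "digit_value \<alpha> ` inter_digits \<tau> \<subseteq> (\<Union>x\<in>prefix_values \<alpha> \<tau> n. {x .. x + \<alpha> ^ n})" for n
    proof
      fix x assume "x \<in> digit_value \<alpha> ` inter_digits \<tau>"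
      then obtain e where e: "e \<in> inter_digits \<tau>" "x = digit_value \<alpha> e" by blast
      let ?t = "digit_value \<alpha> (\<lambda>i. e (i + n))"
      have sg: "signed_digits (\<lambda>i. e (i + n))" by (rule signed_digits_shift[OF inter_digits_signed[OF e(1)]])
      have "\<alpha> / (1 - \<alpha>) \<le> 1" using \<alpha> by (simp add: field_simps)
      then have "?t \<le> 1" using digit_value_le[OF \<alpha> sg] by linarith
      moreover have "0 \<le> ?t" by (rule digit_value_nonneg[OF \<alpha> sg inter_digits_nonneg[OF e(1)]])
      ultimately have t: "0 \<le> \<alpha> ^ n * ?t" "\<alpha> ^ n * ?t \<le> \<alpha> ^ n" using \<alpha> by (auto intro: mult_left_le)
      have "(\<Sum>i<n. of_int (e i) * \<alpha> ^ Suc i) \<in> prefix_values \<alpha> \<tau> n"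
        using e(1) unfolding prefix_values_def by blast
      moreover have "x = (\<Sum>i<n. of_int (e i) * \<alpha> ^ Suc i) + \<alpha> ^ n * ?t"
        unfolding e(2) by (rule digit_value_split[OF \<alpha> inter_digits_signed[OF e(1)]])
      ultimately show "x \<in> (\<Union>x\<in>prefix_values \<alpha> \<tau> n. {x .. x + \<alpha> ^ n})" using t by (intro UN_I) auto
    qed
    show "bounded {x .. x + \<alpha> ^ n} \<and> diameter {x .. x + \<alpha> ^ n} \<le> \<alpha> ^ n" for n x
      using \<alpha> by simp
    show "0 \<le> \<alpha> ^ n" for n using \<alpha> by simp
    show "(\<lambda>n. \<alpha> ^ n) \<longlonglongrightarrow> 0" using \<alpha> by (intro LIMSEQ_realpow_zero) auto
    define q where "q = 2 powr r * \<alpha> powr s"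
    have "\<alpha> powr s < \<alpha> powr (r * (ln 2 / (- ln \<alpha>)))" using s \<alpha> by (intro powr_less_mono') auto
    then have "q < 2 powr r * 2 powr (- r)" unfolding q_def base_powr by (intro mult_strict_left_mono) auto
    then have q: "0 \<le> q" "q < 1" by (auto simp: q_def simp flip: powr_add)
    show "(\<lambda>n. card (prefix_values \<alpha> \<tau> n) * (\<alpha> ^ n) powr s) \<longlonglongrightarrow> 0"
    proof (rule tendsto_sandwich[OF _ _ tendsto_const])
      show "(\<lambda>n. 2 powr C * q ^ n) \<longlonglongrightarrow> 0" using q by (intro tendsto_mult_right_zero LIMSEQ_realpow_zero) auto
      show "\<forall>\<^sub>F n in sequentially. card (prefix_values \<alpha> \<tau> n) * (\<alpha> ^ n) powr s \<le> 2 powr C * q ^ n"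
      proof (intro always_eventually allI)
        fix n
        have "real (card (prefix_values \<alpha> \<tau> n)) \<le> real (2 ^ zero_count \<tau> n)"
          using card_prefix_values[OF \<alpha>] by (simp only: of_nat_le_iff)
        also have "\<dots> = 2 powr (zero_count \<tau> n)" by (simp add: powr_realpow)
        also have "\<dots> \<le> 2 powr (r * n + C)" using count by (intro powr_mono) auto
        also have "\<dots> = 2 powr C * (2 powr r) ^ n"
          by (simp only: powr_realpow[symmetric] powr_gt_zero powr_powr powr_add) simp
        finally have "card (prefix_values \<alpha> \<tau> n) * (\<alpha> ^ n) powr s \<le> 2 powr C * (2 powr r) ^ n * (\<alpha> ^ n) powr s"
          by (intro mult_right_mono) auto
        moreover have "(\<alpha> ^ n) powr s = (\<alpha> powr s) ^ n"
          using \<alpha> by (simp add: powr_powr mult.commute flip: powr_realpow)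
        ultimately show "card (prefix_values \<alpha> \<tau> n) * (\<alpha> ^ n) powr s \<le> 2 powr C * q ^ n"
          by (simp only: q_def power_mult_distrib mult.assoc)
      qed
    qed simp
  qed
  show "hausdorff_dim (digit_value \<alpha> ` inter_digits \<tau>) \<le> z"
    using z le by (cases z) auto
qed

text \<open>
Reading only the free digits, as a binary expansion, maps the set onto the unit interval. Two
points that first differ at position \<open>n\<close> are at least a multiple of \<open>\<alpha> ^ n\<close> apart, while their images
are at most \<open>(1 / 2) ^ zero_count \<tau> n\<close> apart; so the map is Hoelder with the claimed exponent.
\<close>

lemma dim_ge_of_zero_count:
  assumes \<tau>: "signed_digits \<tau>" and "0 \<le> r" and count: "\<And>n. r * n - C \<le> real (zero_count \<tau> n)"
  shows "ereal (r * (ln 2 / (- ln \<alpha>))) \<le> hausdorff_dim (digit_value \<alpha> ` inter_digits \<tau>)"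
proof (cases "r = 0")
  case True
  then show ?thesis unfolding hausdorff_dim_def by (auto intro!: INF_greatest)
next
  case False
  then have "0 < r" using \<open>0 \<le> r\<close> by simp
  define s where "s = r * (ln 2 / (- ln \<alpha>))"
  define N where "N = zero_count \<tau>"
  \<comment> \<open>the weight of a free digit in the binary expansion; forced digits are skipped\<close>
  define w :: "nat \<Rightarrow> real" where "w i = (if \<tau> i = 0 then (1 / 2) ^ Suc (N i) else 0)" for i
  have N_Suc: "N (Suc i) = N i + of_bool (\<tau> i = 0)" for i by (simp add: N_def)
  have w_nonneg: "0 \<le> w i" for i by (simp add: w_def)
  have w_sum: "(\<Sum>i<n. w i) = 1 - (1 / 2) ^ N n" for n
    by (induction n) (auto simp: N_def w_def)
  have half: "(1 / 2) ^ N n \<le> 2 powr C * (2 powr (- r)) ^ n" for n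
  proof -
    have "(1 / 2 :: real) ^ N n = 2 powr (- real (N n))"
      by (simp add: powr_minus powr_realpow power_one_over inverse_eq_divide)
    also have "\<dots> \<le> 2 powr (C - r * n)" using count[of n] unfolding N_def by (intro powr_mono) auto
    also have "\<dots> = 2 powr C * (2 powr (- r)) ^ n"
      by (simp add: powr_powr powr_add[symmetric] powr_realpow[symmetric])
    finally show ?thesis .
  qed
  have half_lim: "(\<lambda>n. (1 / 2 :: real) ^ N n) \<longlonglongrightarrow> 0"
  proof (rule tendsto_sandwich[OF _ _ tendsto_const])
    have "2 powr (- r) < 1" using \<open>0 < r\<close> by (simp add: powr_less_one)
    then show "(\<lambda>n. 2 powr C * (2 powr (- r)) ^ n) \<longlonglongrightarrow> 0"
      by (intro tendsto_mult_right_zero LIMSEQ_realpow_zero) auto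
  qed (use half in auto)
  have "w sums 1"
    unfolding sums_def w_sum using tendsto_diff[OF tendsto_const[of 1] half_lim] by simp
  then have w: "summable w" "suminf w = 1" by (auto simp: sums_iff)
  define \<Phi> where "\<Phi> e = (\<Sum>i. of_int (e i) * w i)" for e :: "nat \<Rightarrow> int"
  define c where "c = (1 - 2 * \<alpha>) / (1 - \<alpha>)"
  have c: "0 < c" "c = 1 - \<alpha> / (1 - \<alpha>)" using \<alpha> by (auto simp: c_def field_simps)
  have summ: "summable (\<lambda>i. of_int (e i) * w i)" if "e \<in> inter_digits \<tau>" for e
  proof (rule summable_comparison_test'[OF w(1)])
    fix i
    show "norm (of_int (e i) * w i) \<le> w i"
      using signed_digits_abs_le[OF inter_digits_signed[OF that], of i] w_nonneg[of i]
      by (auto simp: abs_mult intro!: mult_left_le_one_le)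
  qed
  have close: "\<bar>\<Phi> e - \<Phi> f\<bar> \<le> (1 / 2) ^ N n"
    if e: "e \<in> inter_digits \<tau>" and f: "f \<in> inter_digits \<tau>" and eq: "\<And>i. i < n \<Longrightarrow> e i = f i" for e f n
  proof -
    have sm: "summable (\<lambda>i. of_int (e i) * w i - of_int (f i) * w i)" by (intro summable_diff summ e f)
    have bound: "norm (of_int (e (i + n)) * w (i + n) - of_int (f (i + n)) * w (i + n)) \<le> w (i + n)" for i
    proof -
      have "e (i + n) \<in> {0, 1}" "f (i + n) \<in> {0, 1}" using e f unfolding inter_digits_def by blast+
      then have "\<bar>e (i + n) - f (i + n)\<bar> \<le> 1" by auto
      then have "\<bar>real_of_int (e (i + n)) - of_int (f (i + n))\<bar> \<le> 1" by linarith
      then show ?thesis using w_nonneg[of "i + n"]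
        by (auto simp: abs_mult simp flip: left_diff_distrib intro!: mult_left_le_one_le)
    qed
    have ws: "summable (\<lambda>i. w (i + n))" using w(1) by (rule summable_ignore_initial_segment)
    have "\<Phi> e - \<Phi> f = (\<Sum>i. of_int (e i) * w i - of_int (f i) * w i)"
      unfolding \<Phi>_def by (intro suminf_diff summ e f)
    also have "\<dots> = (\<Sum>i. of_int (e (i + n)) * w (i + n) - of_int (f (i + n)) * w (i + n))"
      using suminf_split_initial_segment[OF sm, of n] eq by simp
    finally have "\<bar>\<Phi> e - \<Phi> f\<bar> \<le> (\<Sum>i. w (i + n))"
      using norm_suminf_le[OF bound ws] by simp
    also have "\<dots> = (1 / 2) ^ N n" using suminf_split_initial_segment[OF w(1), of n] w(2) w_sum[of n] by simp
    finally show ?thesis .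
  qed
  define H where "H = 2 powr C / (c * \<alpha>) powr s"
  show ?thesis
    unfolding s_def[symmetric]
  proof (rule hausdorff_dim_ge_of_Hoelder)
    show "0 < H" using c \<alpha> by (simp add: H_def)
    show "\<bar>\<Phi> e - \<Phi> f\<bar> \<le> H * dist (digit_value \<alpha> e) (digit_value \<alpha> f) powr s"
      if e: "e \<in> inter_digits \<tau>" and f: "f \<in> inter_digits \<tau>" for e f
    proof (cases "e = f")
      case False
      then have ex: "\<exists>i. e i \<noteq> f i" by auto
      define n where "n = (LEAST i. e i \<noteq> f i)"
      have n: "e n \<noteq> f n" unfolding n_def using ex by (rule LeastI_ex)
      have eq: "e i = f i" if "i < n" for i using that not_less_Least[of i] unfolding n_def by blast
      let ?E = "digit_value \<alpha> (\<lambda>i. e (i + Suc n))" and ?F = "digit_value \<alpha> (\<lambda>i. f (i + Suc n))"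
      note sg = inter_digits_signed[OF e] inter_digits_signed[OF f]
      have "0 \<le> ?E" "0 \<le> ?F" "?E \<le> \<alpha> / (1 - \<alpha>)" "?F \<le> \<alpha> / (1 - \<alpha>)"
        by (intro digit_value_nonneg[OF \<alpha>] digit_value_le[OF \<alpha>] signed_digits_shift sg inter_digits_nonneg[OF e] inter_digits_nonneg[OF f])+
      moreover have "real_of_int (e n - f n) \<le> -1 \<or> 1 \<le> real_of_int (e n - f n)" using n by linarith
      ultimately have "c \<le> \<bar>of_int (e n - f n) + ?E - ?F\<bar>" using c(2) by linarith
      then have "\<alpha> ^ Suc n * c \<le> \<alpha> ^ Suc n * \<bar>of_int (e n - f n) + ?E - ?F\<bar>"
        using \<alpha> by (intro mult_left_mono) auto
      also have "\<dots> = \<bar>\<alpha> ^ Suc n * (of_int (e n - f n) + ?E - ?F)\<bar>" using \<alpha> by (simp add: abs_mult)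
      also have "\<alpha> ^ Suc n * (of_int (e n - f n) + ?E - ?F) = digit_value \<alpha> e - digit_value \<alpha> f"
        by (rule digit_value_diff_of_equal_prefix[OF \<alpha> sg eq, symmetric])
      finally have "\<alpha> ^ Suc n * c \<le> dist (digit_value \<alpha> e) (digit_value \<alpha> f)"
        by (simp add: dist_real_def)
      then have "(\<alpha> ^ Suc n * c) powr s \<le> dist (digit_value \<alpha> e) (digit_value \<alpha> f) powr s"
        using c \<alpha> \<open>0 < r\<close> unfolding s_def by (intro powr_mono2 mult_nonneg_nonneg divide_nonneg_pos) auto
      then have "H * (\<alpha> ^ Suc n * c) powr s \<le> H * dist (digit_value \<alpha> e) (digit_value \<alpha> f) powr s"
        using \<open>0 < H\<close> by simp
      moreover have "(\<alpha> ^ Suc n * c) powr s = (c * \<alpha>) powr s * (\<alpha> ^ n) powr s"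
        using \<alpha> c by (simp add: powr_mult mult_ac)
      moreover have "(\<alpha> ^ n) powr s = (\<alpha> powr s) ^ n" using \<alpha> by (simp add: powr_powr mult.commute flip: powr_realpow)
      moreover have "\<alpha> powr s = 2 powr (- r)" unfolding s_def by (rule base_powr)
      ultimately have "2 powr C * (2 powr (- r)) ^ n \<le> H * dist (digit_value \<alpha> e) (digit_value \<alpha> f) powr s"
        using \<alpha> c by (simp add: H_def)
      moreover have "\<bar>\<Phi> e - \<Phi> f\<bar> \<le> (1 / 2) ^ N n" by (rule close[OF e f]) (rule eq)
      ultimately show ?thesis using half[of n] by linarith
    qed (use \<open>0 < H\<close> in simp)
    show "{0..1} \<subseteq> \<Phi> ` inter_digits \<tau>"
    proof
      fix y :: real assume y: "y \<in> {0..1}"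
      \<comment> \<open>greedy binary expansion of \<open>y\<close>: \<open>rest n\<close> is what the digits before \<open>n\<close> have not yet produced\<close>
      define rest where "rest = rec_nat y (\<lambda>i v. v - (if \<tau> i = 0 \<and> w i \<le> v then w i else 0))"
      have rest_0: "rest 0 = y"
        and rest_Suc: "rest (Suc i) = rest i - (if \<tau> i = 0 \<and> w i \<le> rest i then w i else 0)" for i
        by (simp_all add: rest_def)
      define e where "e i = (if \<tau> i = 0 then of_bool (w i \<le> rest i) else max (\<tau> i) 0)" for i
      have "e i \<in> {0, 1} \<and> e i - \<tau> i \<in> {0, 1}" for i
        using signed_digitsD[OF \<tau>, of i] by (auto simp: e_def)
      then have e: "e \<in> inter_digits \<tau>" unfolding inter_digits_def by blast
      have rest: "0 \<le> rest n \<and> rest n \<le> (1 / 2) ^ N n" for n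
      proof (induction n)
        case 0
        then show ?case using y by (simp add: rest_0 N_def)
      next
        case (Suc n)
        then show ?case by (auto simp: rest_Suc N_Suc w_def)
      qed
      have "rest \<longlonglongrightarrow> 0"
        by (rule tendsto_sandwich[OF _ _ tendsto_const half_lim]) (use rest in auto)
      moreover have "(\<Sum>i<n. of_int (e i) * w i) = y - rest n" for n
        by (induction n) (auto simp: rest_0 rest_Suc e_def w_def)
      ultimately have "(\<lambda>i. of_int (e i) * w i) sums y"
        unfolding sums_def using tendsto_diff[OF tendsto_const[of y]] by fastforce
      then have "\<Phi> e = y" unfolding \<Phi>_def by (rule sums_unique[symmetric])
      then show "y \<in> \<Phi> ` inter_digits \<tau>" using e by blast
    qed
  qed simp
qed

end

section \<open>Dense dimensions for small bases\<close>

context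
  fixes \<alpha> :: real
  assumes \<alpha>: "0 < \<alpha>" "\<alpha> < 1 / 2"
begin

lemma binary_value_pos:
  assumes "\<forall>i. d i \<in> {0, 1}" "d k = 1"
  shows "0 < digit_value \<alpha> d"
  unfolding digit_value_def
proof (rule suminf_pos2)
  show "summable (\<lambda>i. of_int (d i) * \<alpha> ^ Suc i)"
    by (rule summable_digits[OF \<alpha> signed_digits_binary[OF assms(1)]])
  show "0 \<le> of_int (d i) * \<alpha> ^ Suc i" for i using assms(1)[rule_format, of i] \<alpha> by auto
  show "0 < of_int (d k) * \<alpha> ^ Suc k" using assms(2) \<alpha> by simp
qed

text \<open>
Exchanging \<open>0\<close> and \<open>1\<close> turns this into \<open>binary_value_pos\<close>.
\<close>

lemma binary_value_less:
  assumes "\<forall>i. d i \<in> {0, 1}" "d k = 0"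
  shows "digit_value \<alpha> d < \<alpha> / (1 - \<alpha>)"
proof -
  have flip: "\<forall>i. 1 - d i \<in> {0, 1}" using assms(1) by auto
  have "digit_value \<alpha> (\<lambda>i. 1 - d i) = digit_value \<alpha> (\<lambda>_. 1) - digit_value \<alpha> d"
    by (rule digit_value_diff[OF \<alpha> _ signed_digits_binary[OF assms(1)]]) (simp add: signed_digits_def)
  moreover have "digit_value \<alpha> (\<lambda>_. 1) = \<alpha> / (1 - \<alpha>)"
    using geometric_sums_Suc[OF \<alpha>] by (simp add: digit_value_def sums_iff)
  moreover have "0 < digit_value \<alpha> (\<lambda>i. 1 - d i)"
    by (rule binary_value_pos[OF flip, of k]) (simp add: assms(2))
  ultimately show ?thesis by simp
qed

text \<open>
The differences of a sequence of zeros and ones are exactly the signed sequences whose nonzero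
digits alternate in sign, beginning with \<open>1\<close> or \<open>-1\<close> according to the first term. Summation by
parts expresses the tail through the values of \<open>S\<close>, and periodicity makes the bounds strict: the
value \<open>S (Suc n)\<close> occurs again later.
\<close>

lemma tail_of_differences_less:
  assumes S: "\<forall>i. S i \<in> {0, 1}" and per: "\<And>i. S (i + p) = S i" and "0 < p"
  shows "\<bar>tail_value \<alpha> (\<lambda>i. S (Suc i) - S i) n\<bar> < \<alpha>"
proof -
  define X where "X = digit_value \<alpha> (\<lambda>i. S (i + Suc n))"
  define Y where "Y = digit_value \<alpha> (\<lambda>i. S (i + Suc (Suc n)))"
  have bin: "\<forall>i. S (i + k) \<in> {0, 1}" for k using S by blast
  have "tail_value \<alpha> (\<lambda>i. S (Suc i) - S i) n = Y - X"
    using digit_value_diff[OF \<alpha> signed_digits_binary[OF bin] signed_digits_binary[OF bin], of "Suc (Suc n)" "Suc n"]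
    unfolding tail_value_def X_def Y_def by simp
  moreover have "X = \<alpha> * (of_int (S (Suc n)) + Y)"
    unfolding X_def Y_def by (rule digit_value_step[OF \<alpha> signed_digits_binary[OF S]])
  ultimately have T: "tail_value \<alpha> (\<lambda>i. S (Suc i) - S i) n = (1 - \<alpha>) * Y - \<alpha> * of_int (S (Suc n))"
    by (simp add: algebra_simps)
  have Y: "0 \<le> Y" "Y \<le> \<alpha> / (1 - \<alpha>)"
    unfolding Y_def using bin[of "Suc (Suc n)"] signed_digits_binary[OF bin[of "Suc (Suc n)"]]
    by (auto intro!: digit_value_nonneg[OF \<alpha>] digit_value_le[OF \<alpha>]) (metis insertE singletonD zero_le_one order_refl)
  \<comment> \<open>\<open>Y\<close> starts at index \<open>n + 2\<close>, so the repetition of \<open>S (n + 1)\<close> is its digit number \<open>p - 1\<close>\<close>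
  have later: "S ((p - 1) + Suc (Suc n)) = S (Suc n)" using per[of "Suc n"] \<open>0 < p\<close> by (simp add: add.commute)
  consider "S (Suc n) = 0" | "S (Suc n) = 1" using S by blast
  then show ?thesis
  proof cases
    case 1
    then have "Y < \<alpha> / (1 - \<alpha>)" unfolding Y_def by (intro binary_value_less[OF bin, of "p - 1"]) (simp only: later)
    then have "(1 - \<alpha>) * Y < \<alpha>" using \<alpha> by (simp add: field_simps)
    moreover have "0 \<le> (1 - \<alpha>) * Y" using Y \<alpha> by simp
    ultimately show ?thesis using T 1 \<alpha> by simp
  next
    case 2
    then have "0 < Y" unfolding Y_def by (intro binary_value_pos[OF bin, of "p - 1"]) (simp only: later)
    then have "0 < (1 - \<alpha>) * Y" using \<alpha> by simp
    moreover have "(1 - \<alpha>) * Y \<le> \<alpha>" using Y \<alpha> by (simp add: field_simps)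
    ultimately show ?thesis using T 2 \<alpha> by simp
  qed
qed

text \<open>
The nonzero digits are placed where \<open>\<lfloor>i * q / p\<rfloor>\<close> jumps, which spreads them with frequency \<open>q / p\<close>
and bounded error. The parity \<open>S\<close> of this floor supplies the alternating signs. After \<open>p\<close> steps the
floor has grown by \<open>q\<close>, which may be odd, so that only \<open>2 * p\<close> is a period of the signs.
\<close>

lemma rational_density_dimension:
  assumes gap: "\<alpha> \<le> (1 - 2 * \<alpha>) / (1 - \<alpha>)" and "q \<le> p" "0 < p"
  shows "ereal ((1 - real q / real p) * (ln 2 / (- ln \<alpha>))) \<in> intersection_dims \<alpha>"
proof -
  define B where "B i = (i * q) div p" for i
  define S where "S i = int (B i) mod 2" for i
  define \<tau> where "\<tau> = (\<lambda>i. S (Suc i) - S i)"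
  have S: "\<forall>i. S i \<in> {0, 1}" unfolding S_def by auto
  have "B (i + 2 * p) = B i + 2 * q" for i
  proof -
    have "(i + 2 * p) * q = i * q + (2 * q) * p" by (simp add: algebra_simps)
    then show ?thesis using \<open>0 < p\<close> unfolding B_def by simp
  qed
  then have per: "S (i + 2 * p) = S i" for i unfolding S_def by simp
  have B_Suc: "B (Suc i) = B i \<or> B (Suc i) = Suc (B i)" for i
  proof -
    have "B i \<le> B (Suc i)" unfolding B_def by (intro div_le_mono) simp
    moreover have "B (Suc i) \<le> (i * q + p) div p" unfolding B_def using \<open>q \<le> p\<close> by (intro div_le_mono) simp
    then have "B (Suc i) \<le> Suc (B i)" using \<open>0 < p\<close> by (simp add: B_def)
    ultimately show ?thesis by linarith
  qed
  have \<tau>0: "\<tau> i = 0 \<longleftrightarrow> B (Suc i) = B i" for i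
    using B_Suc[of i] unfolding \<tau>_def S_def by presburger
  have "\<tau> i \<in> {-1, 0, 1}" for i
    using S[rule_format, of i] S[rule_format, of "Suc i"] unfolding \<tau>_def by auto
  then have \<tau>: "signed_digits \<tau>" unfolding signed_digits_def by blast
  have count: "zero_count \<tau> n + B n = n" for n
  proof (induction n)
    case (Suc n)
    then show ?case using B_Suc[of n] \<tau>0[of n] by auto
  qed (simp add: B_def)
  have "0 < 2 * p" using \<open>0 < p\<close> by simp
  then have "\<bar>tail_value \<alpha> \<tau> n\<bar> < \<alpha>" for n
    unfolding \<tau>_def by (intro tail_of_differences_less[OF S per])
  then have "tail_value \<alpha> \<tau> n < (1 - 2 * \<alpha>) / (1 - \<alpha>) \<and> - ((1 - 2 * \<alpha>) / (1 - \<alpha>)) < tail_value \<alpha> \<tau> n" for n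
    using gap by (smt (verit))
  then have "small_tails \<alpha> \<tau>" unfolding small_tails_def by blast
  then have uniq: "e = \<tau>" if "is_expansion {-1, 0, 1} \<alpha> e (digit_value \<alpha> \<tau>)" for e
    using expansion_unique_of_small_tails[OF \<alpha> \<tau>] that by blast
  have "is_expansion {-1, 0, 1} \<alpha> \<tau> (digit_value \<alpha> \<tau>)"
    using is_signed_expansion_iff[OF \<alpha>] \<tau> by simp
  then have "digit_value \<alpha> \<tau> \<in> unique_expansion_set \<alpha>"
    unfolding unique_expansion_set_def using uniq digit_value_in_Cantor_diff[OF \<alpha> \<tau>] by blast
  moreover have "self_similar (Cantor_inter \<alpha> (digit_value \<alpha> \<tau>))"
  proof (rule self_similar_Cantor_inter[OF \<alpha> \<tau> uniq \<open>0 < 2 * p\<close>])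
    show "\<tau> (i + 2 * p) = \<tau> i" for i using per[of i] per[of "Suc i"] by (simp add: \<tau>_def)
  qed
  ultimately have "hausdorff_dim (Cantor_inter \<alpha> (digit_value \<alpha> \<tau>)) \<in> intersection_dims \<alpha>"
    unfolding intersection_dims_def self_similar_translations_def by blast
  moreover have "hausdorff_dim (digit_value \<alpha> ` inter_digits \<tau>) = ereal ((1 - real q / real p) * (ln 2 / (- ln \<alpha>)))"
  proof (rule antisym)
    have r: "0 \<le> 1 - real q / real p" using \<open>q \<le> p\<close> \<open>0 < p\<close> by simp
    have Bn: "real (B n) \<le> real n * real q / real p" "real n * real q / real p \<le> real (B n) + 1" for n
    proof -
      have "p * B n \<le> n * q" "n * q \<le> p * B n + p"
        using dividend_less_div_times[of p "n * q"] \<open>0 < p\<close>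
        unfolding B_def by (auto simp: mult.commute[of p] add.commute)
      then have "real (p * B n) \<le> real (n * q)" "real (n * q) \<le> real (p * B n + p)"
        by (simp_all only: of_nat_le_iff)
      then show "real (B n) \<le> real n * real q / real p" "real n * real q / real p \<le> real (B n) + 1"
        using \<open>0 < p\<close> by (simp_all add: field_simps)
    qed
    have zc: "real (zero_count \<tau> n) = real n - real (B n)" for n using count[of n] by linarith
    show "hausdorff_dim (digit_value \<alpha> ` inter_digits \<tau>) \<le> ereal ((1 - real q / real p) * (ln 2 / (- ln \<alpha>)))"
    proof (rule dim_le_of_zero_count[OF \<alpha> r, of _ 1])
      show "real (zero_count \<tau> n) \<le> (1 - real q / real p) * real n + 1" for n
        using Bn(2)[of n] zc[of n] by (simp add: algebra_simps)
    qed
    show "ereal ((1 - real q / real p) * (ln 2 / (- ln \<alpha>))) \<le> hausdorff_dim (digit_value \<alpha> ` inter_digits \<tau>)"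
    proof (rule dim_ge_of_zero_count[OF \<alpha> \<tau> r, of 0])
      show "(1 - real q / real p) * real n - 0 \<le> real (zero_count \<tau> n)" for n
        using Bn(1)[of n] zc[of n] by (simp add: algebra_simps)
    qed
  qed
  moreover have "Cantor_inter \<alpha> (digit_value \<alpha> \<tau>) = digit_value \<alpha> ` inter_digits \<tau>"
    by (rule Cantor_inter_eq_digits[OF \<alpha> \<tau> uniq])
  ultimately show ?thesis by (simp only:)
qed

lemma max_dim_pos: "0 < ln 2 / (- ln \<alpha>)"
  using \<alpha> by (intro divide_pos_pos) auto

lemma dimensions_dense:
  assumes "\<alpha> \<le> (1 - 2 * \<alpha>) / (1 - \<alpha>)"
  shows "{0..ereal (ln 2 / (- ln \<alpha>))} \<subseteq> closure (intersection_dims \<alpha>)"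
proof
  define s where "s = ln 2 / (- ln \<alpha>)"
  have s: "0 < s" unfolding s_def by (rule max_dim_pos)
  fix y assume "y \<in> {0..ereal (ln 2 / (- ln \<alpha>))}"
  then obtain v where v: "y = ereal v" "0 \<le> v" "v \<le> s" unfolding s_def[symmetric] by (cases y) auto
  define \<rho> where "\<rho> = v / s"
  have \<rho>: "0 \<le> \<rho>" "\<rho> \<le> 1" "v = \<rho> * s" using v s by (auto simp: \<rho>_def)
  define q where "q k = nat \<lfloor>(1 - \<rho>) * real (Suc k)\<rfloor>" for k
  define r where "r k = 1 - real (q k) / real (Suc k)" for k
  have q: "real (q k) \<le> (1 - \<rho>) * real (Suc k)" "(1 - \<rho>) * real (Suc k) \<le> real (q k) + 1" for k
  proof -
    have "0 \<le> (1 - \<rho>) * real (Suc k)" using \<rho> by simp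
    then have "real (q k) = of_int \<lfloor>(1 - \<rho>) * real (Suc k)\<rfloor>" unfolding q_def by simp
    then show "real (q k) \<le> (1 - \<rho>) * real (Suc k)" "(1 - \<rho>) * real (Suc k) \<le> real (q k) + 1"
      by linarith+
  qed
  have "q k \<le> Suc k" for k
  proof -
    have "(1 - \<rho>) * real (Suc k) \<le> 1 * real (Suc k)" using \<rho> by (intro mult_right_mono) auto
    then have "real (q k) \<le> real (Suc k)" using q(1)[of k] by (metis mult_1 order_trans)
    then show ?thesis by (simp only: of_nat_le_iff)
  qed
  then have mem: "ereal (r k * s) \<in> closure (intersection_dims \<alpha>)" for k
    unfolding r_def s_def
    using rational_density_dimension[OF assms, of "q k" "Suc k"] closure_subset by blast
  have "r \<longlonglongrightarrow> \<rho>"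
  proof (rule tendsto_sandwich[OF _ _ tendsto_const])
    show "(\<lambda>k. \<rho> + inverse (real (Suc k))) \<longlonglongrightarrow> \<rho>" by (rule LIMSEQ_inverse_real_of_nat_add)
    show "\<forall>\<^sub>F k in sequentially. \<rho> \<le> r k"
    proof (intro always_eventually allI)
      fix k
      have "real (q k) / real (Suc k) \<le> 1 - \<rho>"
        using q(1)[of k] by (simp add: pos_divide_le_eq del: of_nat_Suc)
      then show "\<rho> \<le> r k" by (simp add: r_def)
    qed
    show "\<forall>\<^sub>F k in sequentially. r k \<le> \<rho> + inverse (real (Suc k))"
    proof (intro always_eventually allI)
      fix k
      have "1 - \<rho> \<le> (real (q k) + 1) / real (Suc k)"
        using q(2)[of k] by (simp add: pos_le_divide_eq del: of_nat_Suc)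
      then show "r k \<le> \<rho> + inverse (real (Suc k))"
        by (simp add: r_def add_divide_distrib inverse_eq_divide del: of_nat_Suc)
    qed
  qed
  then have "(\<lambda>k. ereal (r k * s)) \<longlonglongrightarrow> y" unfolding v(1) \<rho>(3) by (intro tendsto_ereal tendsto_mult tendsto_const)
  then show "y \<in> closure (intersection_dims \<alpha>)"
    by (rule Lim_in_closed_set[OF closed_closure always_eventually trivial_limit_sequentially, rotated])
      (simp add: mem)
qed

end

section \<open>A gap below the largest dimension for large bases\<close>

text \<open>
A nonzero digit that does not merely continue a run of itself. The condition on tails bites exactly
here, since the digit before is not extreme on the side of the new digit.
\<close>

definition enters_digit :: "(nat \<Rightarrow> int) \<Rightarrow> nat \<Rightarrow> bool" where
  "enters_digit \<tau> k \<longleftrightarrow> \<tau> (Suc k) \<noteq> 0 \<and> \<tau> (Suc k) \<noteq> \<tau> k"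

context
  fixes \<alpha> :: real
  assumes \<alpha>: "0 < \<alpha>" "\<alpha> < 1 / 2"
begin

text \<open>
The tail at \<open>k\<close> is \<open>\<alpha> * (1 + T)\<close>, where \<open>T\<close> is the tail at \<open>Suc k\<close>; being small, it forces
\<open>T < - (\<alpha> ^ M)\<close>. If the next \<open>M\<close> digits were nonnegative, \<open>T\<close> could not be this small. The first
digit \<open>-1\<close> among them is preceded by a larger digit.
\<close>

lemma next_entry_after_one:
  assumes \<tau>: "signed_digits \<tau>" and small: "small_tails \<alpha> \<tau>"
    and M: "(1 - 2 * \<alpha>) / (1 - \<alpha>) \<le> \<alpha> * (1 - \<alpha> ^ M)"
    and k: "\<tau> (Suc k) = 1" "\<tau> k < 1"
  shows "\<exists>j. k < j \<and> j \<le> k + M \<and> enters_digit \<tau> j"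
proof -
  have "\<alpha> * (1 + tail_value \<alpha> \<tau> (Suc k)) = tail_value \<alpha> \<tau> k"
    using digit_value_step[OF \<alpha> \<tau>, of "Suc k"] k(1) unfolding tail_value_def by simp
  also have "\<dots> < (1 - 2 * \<alpha>) / (1 - \<alpha>)" using small k(2) unfolding small_tails_def by blast
  also have "\<dots> \<le> \<alpha> * (1 - \<alpha> ^ M)" by (rule M)
  finally have neg: "tail_value \<alpha> \<tau> (Suc k) < - (\<alpha> ^ M)" using \<alpha> by simp
  have ex: "\<exists>i<M. \<tau> (i + Suc (Suc k)) = -1"
  proof (rule ccontr)
    assume "\<not> ?thesis"
    then have nonneg: "0 \<le> \<tau> (i + Suc (Suc k))" if "i < M" for i
      using that signed_digitsD[OF \<tau>, of "i + Suc (Suc k)"] by auto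
    define Z where "Z = digit_value \<alpha> (\<lambda>i. \<tau> (i + M + Suc (Suc k)))"
    have "signed_digits (\<lambda>i. \<tau> (i + M + Suc (Suc k)))" using \<tau> unfolding signed_digits_def by blast
    then have "- (\<alpha> / (1 - \<alpha>)) \<le> Z" unfolding Z_def by (rule digit_value_ge[OF \<alpha>])
    moreover have "\<alpha> / (1 - \<alpha>) \<le> 1" using \<alpha> by (simp add: field_simps)
    ultimately have "-1 \<le> Z" by linarith
    then have "\<alpha> ^ M * (-1) \<le> \<alpha> ^ M * Z" using \<alpha> by (intro mult_left_mono) auto
    moreover have "tail_value \<alpha> \<tau> (Suc k) = (\<Sum>i<M. of_int (\<tau> (i + Suc (Suc k))) * \<alpha> ^ Suc i) + \<alpha> ^ M * Z"
      unfolding tail_value_def Z_def by (rule digit_value_split[OF \<alpha> signed_digits_shift[OF \<tau>]])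
    moreover have "0 \<le> (\<Sum>i<M. of_int (\<tau> (i + Suc (Suc k))) * \<alpha> ^ Suc i)"
      using nonneg \<alpha> by (intro sum_nonneg mult_nonneg_nonneg) auto
    ultimately show False using neg by linarith
  qed
  define i where "i = (LEAST i. \<tau> (i + Suc (Suc k)) = -1)"
  have i: "\<tau> (i + Suc (Suc k)) = -1" unfolding i_def using ex by (metis (mono_tags) LeastI)
  have "i < M" using ex unfolding i_def by (meson Least_le le_less_trans)
  have "\<tau> (i + Suc k) \<noteq> -1"
  proof (cases i)
    case 0
    then show ?thesis using k(1) by simp
  next
    case (Suc i')
    then have "\<tau> (i' + Suc (Suc k)) \<noteq> -1" unfolding i_def by (metis (mono_tags) lessI not_less_Least)
    then show ?thesis using Suc by simp
  qed
  then have "enters_digit \<tau> (i + Suc k)" using i by (simp add: enters_digit_def)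
  then show ?thesis using \<open>i < M\<close> by (intro exI[of _ "i + Suc k"]) auto
qed

lemma next_entry:
  assumes \<tau>: "signed_digits \<tau>" and small: "small_tails \<alpha> \<tau>"
    and M: "(1 - 2 * \<alpha>) / (1 - \<alpha>) \<le> \<alpha> * (1 - \<alpha> ^ M)" and k: "enters_digit \<tau> k"
  shows "\<exists>j. k < j \<and> j \<le> k + M \<and> enters_digit \<tau> j"
proof -
  consider "\<tau> (Suc k) = 1" "\<tau> k < 1" | "- \<tau> (Suc k) = 1" "- \<tau> k < 1"
    using k signed_digitsD[OF \<tau>, of k] signed_digitsD[OF \<tau>, of "Suc k"] unfolding enters_digit_def by auto
  then show ?thesis
  proof cases
    case 1
    then show ?thesis by (rule next_entry_after_one[OF \<tau> small M])
  next
    case 2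
    have "\<exists>j. k < j \<and> j \<le> k + M \<and> enters_digit (\<lambda>i. - \<tau> i) j"
      using next_entry_after_one[OF _ small_tails_minus[OF \<alpha> \<tau> small] M, of k] \<tau> 2 by simp
    then show ?thesis by (simp add: enters_digit_def)
  qed
qed

end

lemma zero_count_add_le: "zero_count \<tau> (n + m) \<le> zero_count \<tau> n + m"
  by (induction m) auto

lemma zero_count_le_of_nonzero_windows:
  assumes "0 < M" and windows: "\<And>n. k \<le> n \<Longrightarrow> \<exists>j. n \<le> j \<and> j < n + M \<and> \<tau> j \<noteq> 0"
  shows "real (zero_count \<tau> n) \<le> (1 - 1 / real M) * real n + real (k + M)"
proof (induction n rule: less_induct)
  case (less n)
  show ?case
  proof (cases "n < k + M")
    case True
    have "zero_count \<tau> n \<le> n" using zero_count_add_le[of \<tau> 0 n] by simp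
    moreover have "0 \<le> (1 - 1 / real M) * real n" using \<open>0 < M\<close> by simp
    ultimately show ?thesis using True by linarith
  next
    case False
    define m where "m = n - M"
    have m: "n = m + M" "k \<le> m" using False by (auto simp: m_def)
    then obtain j where j: "m \<le> j" "j < m + M" "\<tau> j \<noteq> 0" using windows by blast
    define h l where "h = j - m" and "l = n - Suc j"
    have hl: "j = m + h" "n = Suc j + l" "h + l + 1 = M" using j m(1) by (auto simp: h_def l_def)
    have "zero_count \<tau> n \<le> zero_count \<tau> (Suc j) + l"
      unfolding hl(2) by (rule zero_count_add_le)
    moreover have "zero_count \<tau> (Suc j) = zero_count \<tau> j" using j(3) by simp
    moreover have "zero_count \<tau> j \<le> zero_count \<tau> m + h"
      unfolding hl(1) by (rule zero_count_add_le)
    ultimately have "real (zero_count \<tau> n) + 1 \<le> real (zero_count \<tau> m) + real M"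
      using hl(3) by linarith
    moreover have "real (zero_count \<tau> m) \<le> (1 - 1 / real M) * real m + real (k + M)"
      using less m \<open>0 < M\<close> by simp
    moreover have "(1 - 1 / real M) * real n = (1 - 1 / real M) * real m + real M - 1"
      using \<open>0 < M\<close> m(1) by (simp add: field_simps)
    ultimately show ?thesis by linarith
  qed
qed

context
  fixes \<alpha> :: real
  assumes \<alpha>: "0 < \<alpha>" "\<alpha> < 1 / 2"
begin

text \<open>
Once a digit has been entered, entries recur within every window of length \<open>M\<close>. If no digit is ever
entered, a nonzero digit can only be preceded by itself; so unless the digits are eventually zero,
they never vanish.
\<close>

lemma zeros_eventually_or_sparse:
  assumes \<tau>: "signed_digits \<tau>" and small: "small_tails \<alpha> \<tau>" and "0 < M"
    and M: "(1 - 2 * \<alpha>) / (1 - \<alpha>) \<le> \<alpha> * (1 - \<alpha> ^ M)"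
  shows "(\<exists>k. \<forall>n\<ge>k. \<tau> n = 0) \<or> (\<exists>C. \<forall>n. real (zero_count \<tau> n) \<le> (1 - 1 / real M) * real n + C)"
proof (cases "\<exists>k. enters_digit \<tau> k")
  case True
  then obtain k where k: "enters_digit \<tau> k" by blast
  have entries: "\<exists>j. n \<le> j \<and> j < n + M \<and> enters_digit \<tau> j" if "k \<le> n" for n
    using that
  proof (induction n rule: dec_induct)
    case base
    then show ?case using k \<open>0 < M\<close> by auto
  next
    case (step n)
    then obtain j where j: "n \<le> j" "j < n + M" "enters_digit \<tau> j" by blast
    show ?case
    proof (cases "j = n")
      case True
      obtain i where "j < i" "i \<le> j + M" "enters_digit \<tau> i"
        using next_entry[OF \<alpha> \<tau> small M j(3)] by blast
      then show ?thesis using \<open>j = n\<close> by (intro exI[of _ i]) auto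
    next
      case False
      then show ?thesis using j by (intro exI[of _ j]) auto
    qed
  qed
  have "\<exists>j. n \<le> j \<and> j < n + M \<and> \<tau> j \<noteq> 0" if "Suc k \<le> n" for n
  proof -
    define n' where "n' = n - 1"
    have n': "n = Suc n'" "k \<le> n'" using that by (auto simp: n'_def)
    obtain j where "n' \<le> j" "j < n' + M" "enters_digit \<tau> j" using entries[OF n'(2)] by blast
    then show ?thesis using n'(1) by (intro exI[of _ "Suc j"]) (auto simp: enters_digit_def)
  qed
  then show ?thesis using zero_count_le_of_nonzero_windows[OF \<open>0 < M\<close>, of "Suc k" \<tau>] by blast
next
  case False
  show ?thesis
  proof (cases "\<exists>k. \<forall>n\<ge>k. \<tau> n = 0")
    case infinite: False
    have "\<tau> i \<noteq> 0" for i
    proof -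
      obtain n where n: "i \<le> n" "\<tau> n \<noteq> 0" using infinite by blast
      from n(1) show ?thesis
      proof (induction rule: inc_induct)
        case (step m)
        then show ?case using False unfolding enters_digit_def by metis
      qed (rule n(2))
    qed
    then have "zero_count \<tau> n = 0" for n by (simp add: zero_count_def)
    then show ?thesis using \<open>0 < M\<close> by (intro disjI2 exI[of _ 0]) simp
  qed simp
qed

lemma unique_expansion_dimension_gap:
  assumes "1 / 3 \<le> \<alpha>" "0 < M" and M: "(1 - 2 * \<alpha>) / (1 - \<alpha>) \<le> \<alpha> * (1 - \<alpha> ^ M)"
    and t: "t \<in> unique_expansion_set \<alpha>"
  shows "hausdorff_dim (Cantor_inter \<alpha> t) \<le> ereal ((1 - 1 / real M) * (ln 2 / (- ln \<alpha>)))
    \<or> ereal (ln 2 / (- ln \<alpha>)) \<le> hausdorff_dim (Cantor_inter \<alpha> t)"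
proof -
  obtain \<tau> where \<tau>': "is_expansion {-1, 0, 1} \<alpha> \<tau> t"
    and uniq': "\<And>e. is_expansion {-1, 0, 1} \<alpha> e t \<Longrightarrow> e = \<tau>"
    using t unfolding unique_expansion_set_def by blast
  have \<tau>: "signed_digits \<tau>" and t_eq: "t = digit_value \<alpha> \<tau>"
    using \<tau>' is_signed_expansion_iff[OF \<alpha>] by simp_all
  note uniq = uniq'[unfolded t_eq]
  have K: "Cantor_inter \<alpha> t = digit_value \<alpha> ` inter_digits \<tau>"
    unfolding t_eq by (rule Cantor_inter_eq_digits[OF \<alpha> \<tau> uniq])
  have small: "small_tails \<alpha> \<tau>" by (rule small_tails_of_unique[OF \<alpha> assms(1) \<tau> uniq])
  from zeros_eventually_or_sparse[OF \<tau> small \<open>0 < M\<close> M] show ?thesis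
  proof (elim disjE exE)
    fix k assume k: "\<forall>n\<ge>k. \<tau> n = 0"
    have "real n - real k \<le> real (zero_count \<tau> n)" for n
    proof (induction n)
      case (Suc n)
      then show ?case using k by (cases "k \<le> n") auto
    qed simp
    then have "ereal (1 * (ln 2 / (- ln \<alpha>))) \<le> hausdorff_dim (digit_value \<alpha> ` inter_digits \<tau>)"
      by (intro dim_ge_of_zero_count[OF \<alpha> \<tau>, of 1 k]) auto
    then show ?thesis unfolding K by simp
  next
    fix C assume "\<forall>n. real (zero_count \<tau> n) \<le> (1 - 1 / real M) * real n + C"
    then show ?thesis
      unfolding K using \<open>0 < M\<close> by (intro disjI1 dim_le_of_zero_count[OF \<alpha>, of _ _ C]) auto
  qed
qed

text \<open>
The strict inequality leaves room for some \<open>M\<close> that satisfies the hypothesis of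
\<open>unique_expansion_dimension_gap\<close>. The number
\<open>(1 - 1 / (2 * M)) * s\<close> lies inside the gap, whose complement is closed.
\<close>

lemma dimensions_not_dense:
  assumes "1 / 3 \<le> \<alpha>" and gap: "(1 - 2 * \<alpha>) / (1 - \<alpha>) < \<alpha>"
  shows "\<not> {0..ereal (ln 2 / (- ln \<alpha>))} \<subseteq> closure (intersection_dims \<alpha>)"
proof
  assume dense: "{0..ereal (ln 2 / (- ln \<alpha>))} \<subseteq> closure (intersection_dims \<alpha>)"
  define s where "s = ln 2 / (- ln \<alpha>)"
  have s: "0 < s" unfolding s_def by (rule max_dim_pos[OF \<alpha>])
  have "(\<lambda>n. \<alpha> * (1 - \<alpha> ^ Suc n)) \<longlonglongrightarrow> \<alpha> * (1 - 0)"
    using \<alpha> by (intro tendsto_intros LIMSEQ_Suc LIMSEQ_realpow_zero) auto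
  then have "\<forall>\<^sub>F n in sequentially. (1 - 2 * \<alpha>) / (1 - \<alpha>) < \<alpha> * (1 - \<alpha> ^ Suc n)"
    using gap by (intro order_tendstoD) auto
  then obtain n where n: "(1 - 2 * \<alpha>) / (1 - \<alpha>) < \<alpha> * (1 - \<alpha> ^ Suc n)"
    using eventually_happens by force
  define M where "M = Suc n"
  have M: "0 < M" "(1 - 2 * \<alpha>) / (1 - \<alpha>) \<le> \<alpha> * (1 - \<alpha> ^ M)" using n by (auto simp: M_def)
  have "intersection_dims \<alpha> \<subseteq> {..ereal ((1 - 1 / real M) * s)} \<union> {ereal s..}"
    unfolding intersection_dims_def self_similar_translations_def s_def
    using unique_expansion_dimension_gap[OF assms(1) M] by auto
  then have "closure (intersection_dims \<alpha>) \<subseteq> {..ereal ((1 - 1 / real M) * s)} \<union> {ereal s..}"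
    by (intro closure_minimal closed_Un) auto
  moreover have "ereal ((1 - 1 / (2 * real M)) * s) \<in> {0..ereal s}"
    using s M(1) by (auto simp: zero_ereal_def intro!: mult_nonneg_nonneg mult_left_le_one_le)
  ultimately have "ereal ((1 - 1 / (2 * real M)) * s) \<in> {..ereal ((1 - 1 / real M) * s)} \<union> {ereal s..}"
    using dense unfolding s_def by blast
  moreover have "(1 - 1 / real M) * s < (1 - 1 / (2 * real M)) * s"
    using s M(1) by (intro mult_strict_right_mono) (auto simp: field_simps)
  moreover have "(1 - 1 / (2 * real M)) * s < 1 * s"
    using s M(1) by (intro mult_strict_right_mono) auto
  ultimately show False by auto
qed

end

theorem theorem1p3:
  fixes \<alpha> :: real
  shows "(1 / 3 < \<alpha> \<and> \<alpha> \<le> (3 - sqrt 5) / 2 \<longrightarrow>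
            {0..ereal (ln 2 / (- ln \<alpha>))} \<subseteq> closure (intersection_dims \<alpha>)) \<and>
         ((3 - sqrt 5) / 2 < \<alpha> \<and> \<alpha> < 1 / 2 \<longrightarrow>
            \<not> {0..ereal (ln 2 / (- ln \<alpha>))} \<subseteq> closure (intersection_dims \<alpha>))"
proof (intro conjI impI; elim conjE)
  assume a: "1 / 3 < \<alpha>" "\<alpha> \<le> (3 - sqrt 5) / 2"
  \<comment> \<open>\<open>\<alpha> \<le> (1 - 2 * \<alpha>) / (1 - \<alpha>)\<close> amounts to \<open>5 \<le> (3 - 2 * \<alpha>)\<^sup>2\<close>\<close>
  have "2 < sqrt 5" by (rule real_less_rsqrt) simp
  then have "(3 - sqrt 5) / 2 < 1 / 2" by simp
  then have \<alpha>: "0 < \<alpha>" "\<alpha> < 1 / 2" using a by simp_all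
  have "sqrt 5 \<le> 3 - 2 * \<alpha>" using a by simp
  then have "(sqrt 5)\<^sup>2 \<le> (3 - 2 * \<alpha>)\<^sup>2" by (intro power_mono) auto
  then have "\<alpha> \<le> (1 - 2 * \<alpha>) / (1 - \<alpha>)" using \<alpha> by (simp add: field_simps power2_eq_square)
  then show "{0..ereal (ln 2 / (- ln \<alpha>))} \<subseteq> closure (intersection_dims \<alpha>)"
    by (rule dimensions_dense[OF \<alpha>])
next
  assume a: "(3 - sqrt 5) / 2 < \<alpha>" "\<alpha> < 1 / 2"
  have "sqrt 5 < 7 / 3" by (rule real_less_lsqrt) (auto simp: power2_eq_square)
  then have "1 / 3 \<le> (3 - sqrt 5) / 2" by simp
  then have third: "1 / 3 \<le> \<alpha>" using a(1) by simp
  then have \<alpha>: "0 < \<alpha>" "\<alpha> < 1 / 2" using a(2) by simp_all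
  have "3 - 2 * \<alpha> < sqrt 5" using a by simp
  then have "(3 - 2 * \<alpha>)\<^sup>2 < (sqrt 5)\<^sup>2" using a by (intro power_strict_mono) auto
  then have "(1 - 2 * \<alpha>) / (1 - \<alpha>) < \<alpha>" using \<alpha> by (simp add: field_simps power2_eq_square)
  then show "\<not> {0..ereal (ln 2 / (- ln \<alpha>))} \<subseteq> closure (intersection_dims \<alpha>)"
    by (rule dimensions_not_dense[OF \<alpha> third])
qed

end
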